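(* Let $f,g\in L^2(\mathbb{R}^{2d},\mathbb{H})$ with $f\neq0$ and $g\neq0$. Then $$E\big(|W(f,g)|^2\big)\ge\|f\|_{2,2d}^2\|g\|_{2,2d}^2\Big(2d\ln2-\ln\big(2^{4d}\|f\|_{2,2d}^2\|g\|_{2,2d}^2\big)\Big).$$
   Context: $d\ge 1$ is an integer and $\mathbb{H}$ is the algebra of quaternions with units $i,j,k$. On $\mathbb{R}^n$, $d\mu_n(x)=dx/(2\pi)^{n/2}$, $\|f\|_{2,n}=\big(\int_{\mathbb{R}^n}|f|^2d\mu_n\big)^{1/2}$, and $\mathbb{R}^{2d}\times\mathbb{R}^{2d}$ is identified with $\mathbb{R}^{4d}$. The quaternion Wigner transform is $$W(f,g)(x,w)=\int_{\mathbb{R}^{2d}}e^{-i\,w_1\cdot t_1}f\big(x+\tfrac t2\big)\overline{g\big(x-\tfrac t2\big)}e^{-j\,w_2\cdot t_2}\,d\mu_{2d}(t),\quad x\in\mathbb{R}^{2d},\ w=(w_1,w_2),\ t=(t_1,t_2)\in\mathbb{R}^d\times\mathbb{R}^d.$$ The entropy of a non-negative integrable function $P$ on $\mathbb{R}^{2d}\times\mathbb{R}^{2d}$ is $E(P)=-\iint_{\mathbb{R}^{2d}\times\mathbb{R}^{2d}}\ln(P(x,w))\,P(x,w)\,d\mu_{4d}(x,w)$ (with $0\ln0=0$), which is allowed to be $+\infty$. *)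

theory Defs
  imports "HOL-Analysis.Analysis"
begin

datatype quat = Quat (qRe: real) (qI: real) (qJ: real) (qK: real)

lemma quat_eq_iff: "x = y \<longleftrightarrow> qRe x = qRe y \<and> qI x = qI y \<and> qJ x = qJ y \<and> qK x = qK y"
  by (cases x; cases y) simp

instantiation quat :: ring_1
begin

definition "0 = Quat 0 0 0 0"
definition "1 = Quat 1 0 0 0"
definition "x + y = Quat (qRe x + qRe y) (qI x + qI y) (qJ x + qJ y) (qK x + qK y)"
definition "x - y = Quat (qRe x - qRe y) (qI x - qI y) (qJ x - qJ y) (qK x - qK y)"
definition "- x = Quat (- qRe x) (- qI x) (- qJ x) (- qK x)"
definition "x * y = Quat
  (qRe x * qRe y - qI x * qI y - qJ x * qJ y - qK x * qK y)
  (qRe x * qI y + qI x * qRe y + qJ x * qK y - qK x * qJ y)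
  (qRe x * qJ y - qI x * qK y + qJ x * qRe y + qK x * qI y)
  (qRe x * qK y + qI x * qJ y - qJ x * qI y + qK x * qRe y)"

instance
  by standard
    (auto simp: quat_eq_iff zero_quat_def one_quat_def plus_quat_def minus_quat_def
      uminus_quat_def times_quat_def algebra_simps)

end

lemma quat_sel [simp]:
  "qRe 0 = 0" "qI 0 = 0" "qJ 0 = 0" "qK 0 = 0"
  "qRe 1 = 1" "qI 1 = 0" "qJ 1 = 0" "qK 1 = 0"
  "qRe (x + y) = qRe x + qRe y" "qI (x + y) = qI x + qI y"
  "qJ (x + y) = qJ x + qJ y" "qK (x + y) = qK x + qK y"
  "qRe (x - y) = qRe x - qRe y" "qI (x - y) = qI x - qI y"
  "qJ (x - y) = qJ x - qJ y" "qK (x - y) = qK x - qK y"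
  "qRe (- x) = - qRe x" "qI (- x) = - qI x" "qJ (- x) = - qJ x" "qK (- x) = - qK x"
  by (simp_all add: zero_quat_def one_quat_def plus_quat_def minus_quat_def uminus_quat_def)

lemma quat_sel_times [simp]:
  "qRe (x * y) = qRe x * qRe y - qI x * qI y - qJ x * qJ y - qK x * qK y"
  "qI (x * y) = qRe x * qI y + qI x * qRe y + qJ x * qK y - qK x * qJ y"
  "qJ (x * y) = qRe x * qJ y - qI x * qK y + qJ x * qRe y + qK x * qI y"
  "qK (x * y) = qRe x * qK y + qI x * qJ y - qJ x * qI y + qK x * qRe y"
  by (simp_all add: times_quat_def)

instantiation quat :: real_algebra_1
begin

definition "scaleR r x = Quat (r * qRe x) (r * qI x) (r * qJ x) (r * qK x)"

instance
  by standard (auto simp: quat_eq_iff scaleR_quat_def algebra_simps)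

end

lemma quat_sel_scaleR [simp]:
  "qRe (r *\<^sub>R x) = r * qRe x" "qI (r *\<^sub>R x) = r * qI x"
  "qJ (r *\<^sub>R x) = r * qJ x" "qK (r *\<^sub>R x) = r * qK x"
  by (simp_all add: scaleR_quat_def)

lemma quat_sq_eq_0_iff:
  "(qRe x)\<^sup>2 + (qI x)\<^sup>2 + (qJ x)\<^sup>2 + (qK x)\<^sup>2 = 0 \<longleftrightarrow> x = 0"
  by (simp add: quat_eq_iff add_nonneg_eq_0_iff)

instantiation quat :: real_inner
begin

definition "inner x y = qRe x * qRe y + qI x * qI y + qJ x * qJ y + qK x * qK y"
definition "norm x = sqrt ((qRe x)\<^sup>2 + (qI x)\<^sup>2 + (qJ x)\<^sup>2 + (qK x)\<^sup>2)" for x :: quat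
definition "sgn x = x /\<^sub>R norm x" for x :: quat
definition "dist x y = norm (x - y)" for x y :: quat
definition "(uniformity :: (quat \<times> quat) filter) =
  (INF e\<in>{0 <..}. principal {(x, y). dist x y < e})"
definition "open (U :: quat set) \<longleftrightarrow>
  (\<forall>x\<in>U. eventually (\<lambda>(x', y). x' = x \<longrightarrow> y \<in> U) uniformity)"

instance
proof
  fix x y z :: quat and r :: real and U :: "quat set"
  show "inner x x = 0 \<longleftrightarrow> x = 0"
    using quat_sq_eq_0_iff[of x] by (simp add: inner_quat_def power2_eq_square)
  show "norm x = sqrt (inner x x)"
    by (simp add: inner_quat_def norm_quat_def power2_eq_square)
  show "sgn x = x /\<^sub>R norm x"
    by (rule sgn_quat_def)
  show "dist x y = norm (x - y)"
    by (rule dist_quat_def)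
  show "(uniformity :: (quat \<times> quat) filter) =
      (INF e\<in>{0 <..}. principal {(x, y). dist x y < e})"
    by (rule uniformity_quat_def)
  show "open U \<longleftrightarrow> (\<forall>x\<in>U. eventually (\<lambda>(x', y). x' = x \<longrightarrow> y \<in> U) uniformity)"
    by (rule open_quat_def)
qed (simp_all add: inner_quat_def algebra_simps)

end

instantiation quat :: real_normed_div_algebra
begin

definition "inverse x = Quat (qRe x) (- qI x) (- qJ x) (- qK x) /\<^sub>R (norm x)\<^sup>2" for x :: quat
definition "x div y = x * inverse y" for x y :: quat

instance
proof
  fix x y :: quat
  have sq: "(norm z)\<^sup>2 = (qRe z)\<^sup>2 + (qI z)\<^sup>2 + (qJ z)\<^sup>2 + (qK z)\<^sup>2" for z :: quat
    by (simp add: norm_quat_def)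
  have "(norm (x * y))\<^sup>2 = (norm x * norm y)\<^sup>2"
    unfolding power_mult_distrib sq quat_sel_times by algebra
  then show "norm (x * y) = norm x * norm y"
    by (rule power2_eq_imp_eq) (simp_all add: norm_quat_def)
  have conj: "z * Quat (qRe z) (- qI z) (- qJ z) (- qK z) = (norm z)\<^sup>2 *\<^sub>R 1"
    "Quat (qRe z) (- qI z) (- qJ z) (- qK z) * z = (norm z)\<^sup>2 *\<^sub>R 1" for z
    unfolding sq by (simp_all add: quat_eq_iff power2_eq_square)
  show "x \<noteq> 0 \<Longrightarrow> inverse x * x = 1" "x \<noteq> 0 \<Longrightarrow> x * inverse x = 1"
    by (simp_all add: inverse_quat_def conj)
  show "inverse (0 :: quat) = 0"
    by (simp add: inverse_quat_def)
  show "x div y = x * inverse y"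
    by (simp add: divide_quat_def)
qed

end

definition quat_i :: quat where "quat_i = Quat 0 1 0 0"
definition quat_j :: quat where "quat_j = Quat 0 0 1 0"
definition quat_k :: quat where "quat_k = Quat 0 0 0 1"

definition quat_cnj :: "quat \<Rightarrow> quat" where
  "quat_cnj x = Quat (qRe x) (- qI x) (- qJ x) (- qK x)"

instantiation quat :: euclidean_space
begin

definition "Basis = {1, quat_i, quat_j, quat_k}"

instance
proof
  fix u v x :: quat
  show "(Basis :: quat set) \<noteq> {}" "finite (Basis :: quat set)"
    by (simp_all add: Basis_quat_def)
  show "u \<in> Basis \<Longrightarrow> v \<in> Basis \<Longrightarrow> u \<bullet> v = (if u = v then 1 else 0)"
    unfolding Basis_quat_def one_quat_def quat_i_def quat_j_def quat_k_def
    by (elim insertE emptyE) (simp_all add: inner_quat_def)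
  show "(\<forall>u\<in>Basis. x \<bullet> u = 0) \<longleftrightarrow> x = 0"
    by (simp add: Basis_quat_def inner_quat_def quat_i_def quat_j_def quat_k_def quat_eq_iff[of x])
qed

end

lemma quat_units:
  "quat_i * quat_i = -1" "quat_j * quat_j = -1" "quat_k * quat_k = -1"
  "quat_i * quat_j = quat_k" "quat_j * quat_k = quat_i" "quat_k * quat_i = quat_j"
  "quat_j * quat_i = - quat_k" "quat_k * quat_j = - quat_i" "quat_i * quat_k = - quat_j"
  by (simp_all add: quat_eq_iff quat_i_def quat_j_def quat_k_def)


text \<open>\<open>real ^ 'd\<close> plays the role of the d-dimensional space, with d = \<open>CARD('d)\<close>; its square
  is the 2d-dimensional space and the product of two copies of that is phase space.\<close>

definition mu :: "'a::euclidean_space measure" where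
  "mu = density lebesgue (\<lambda>_. ennreal (1 / (2 * pi) powr (real DIM('a) / 2)))"

text \<open>Functions are genuine functions rather than classes modulo null sets; all notions below
  depend only on the class.\<close>

definition L2 :: "('a::euclidean_space \<Rightarrow> quat) set" where
  "L2 = {f. f \<in> borel_measurable lebesgue \<and> integrable mu (\<lambda>x. (norm (f x))\<^sup>2)}"

definition L2_norm :: "('a::euclidean_space \<Rightarrow> quat) \<Rightarrow> real" where
  "L2_norm f = sqrt (\<integral>x. (norm (f x))\<^sup>2 \<partial>mu)"

definition wigner ::
  "((real^'d) \<times> (real^'d) \<Rightarrow> quat) \<Rightarrow> ((real^'d) \<times> (real^'d) \<Rightarrow> quat)
    \<Rightarrow> (real^'d) \<times> (real^'d) \<Rightarrow> (real^'d) \<times> (real^'d) \<Rightarrow> quat"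
where
  "wigner f g x w =
    (\<integral>t. exp (- ((fst w \<bullet> fst t) *\<^sub>R quat_i)) * f (x + t /\<^sub>R 2) * quat_cnj (g (x - t /\<^sub>R 2))
        * exp (- ((snd w \<bullet> snd t) *\<^sub>R quat_j)) \<partial>mu)"

text \<open>The extended integral of \<open>ln P * P\<close> is positive part minus negative part. If both are
  infinite, their \<^typ>\<open>ereal\<close> difference is \<open>\<infinity>\<close>, so the value here is \<open>- \<infinity>\<close> and a lower bound on
  the entropy never holds merely because the integral is undefined. The convention
  \<open>0 ln 0 = 0\<close> is automatic.\<close>

definition phase_entropy :: "('a::euclidean_space \<times> 'a \<Rightarrow> real) \<Rightarrow> ereal" where
  "phase_entropy P =
    - (enn2ereal (\<integral>\<^sup>+z. ennreal (ln (P z) * P z) \<partial>mu)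
       - enn2ereal (\<integral>\<^sup>+z. ennreal (- (ln (P z) * P z)) \<partial>mu))"

end

theory Submission
  imports Defs "HOL-Probability.Characteristic_Functions"
begin

text \<open>Write \<open>N\<close> for the product of the squared norms, \<open>P = |W(f,g)|\<^sup>2\<close> and \<open>D\<close> for the dimension of one
  block of variables, so that the claimed bound is \<open>- N ln c\<close> with \<open>c = 4\<^sup>D N\<close>. Integrating
  \<open>P ln P \<le> P ln c + P\<^sup>2 / c - P\<close> reduces it to \<open>\<integral> P = N\<close> and \<open>\<integral> P\<^sup>2 \<le> c N\<close>: only the second moment
  is needed, not a family of sharp \<open>L\<^sup>p\<close> bounds.

  The first identity is Plancherel's theorem, applied to the left transform in the first block and then
  to the right transform in the second one. For the second, the \<open>L\<^sup>4\<close> norm of a Fourier transform is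
  the \<open>L\<^sup>2\<close> norm of a convolution square; in one block the resulting integral over \<open>x\<close> of a product of
  eight values of \<open>|f|\<close> and \<open>|g|\<close> is bounded sharply by a single application of Cauchy-Schwarz that pairs
  the values of \<open>f\<close> against the values of \<open>g\<close>. Minkowski's inequality lets the two blocks be treated
  one after the other, which avoids the mixed real-imaginary terms of the two-sided transform.\<close>

section \<open>Normalized Lebesgue measure\<close>

text \<open>The bound is \<open>- N ln (4 ^ D * N)\<close> because the term \<open>2 D ln 2\<close>
  cancels half of the \<open>4 D ln 2\<close> hidden in the last logarithm. Cauchy-Schwarz at each
  point gives \<open>P \<le> 16 ^ D * N\<close>, which proves the bound only without that term; the
  second moment supplies the rest. In \<open>c\<close> the factor \<open>4 ^ D\<close> is one
  \<open>2 ^ D\<close> from each block, and \<open>c\<close> is the ratio of the second-moment bound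
  to the mass, the value for which the integrated inequality is best.

  The obstacle is noncommutativity: a product of two quaternion transforms is not the transform of a
  convolution. A kernel on the left alone, however, acts as a complex character on both parts of
  \<open>x = a + b j\<close>, so the complex convolution theorem and Plancherel apply to each part;
  an anti-automorphism reduces a right kernel to a left one.

  \<open>mu\<close> is a density on the completed measure, which is not a product measure. Fubini
  arguments therefore run over the Borel measure \<open>nlborel\<close>; replacing \<open>f\<close>
  and \<open>g\<close> by Borel functions changes no value of the transform.\<close>

definition nlborel :: "'a::euclidean_space measure" where
  "nlborel = density lborel (\<lambda>_. ennreal (1 / (2 * pi) powr (real DIM('a) / 2)))"

lemma sets_nlborel [simp, measurable_cong]: "sets nlborel = sets borel"
  and space_nlborel [simp]: "space nlborel = UNIV"
  by (simp_all add: nlborel_def)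

lemma borel_measurable_nlborel [simp]: "borel_measurable nlborel = borel_measurable borel"
  by (simp cong: measurable_cong_sets)

lemma nn_integral_nlborel:
  fixes f :: "'a::euclidean_space \<Rightarrow> ennreal"
  assumes "f \<in> borel_measurable borel"
  shows "(\<integral>\<^sup>+x. f x \<partial>nlborel) = ennreal (1 / (2 * pi) powr (real DIM('a) / 2)) * (\<integral>\<^sup>+x. f x \<partial>lborel)"
  using assms by (simp add: nlborel_def nn_integral_density nn_integral_cmult)

lemma sigma_finite_nlborel: "sigma_finite_measure (nlborel :: 'a::euclidean_space measure)"
  unfolding nlborel_def
  by (subst sigma_finite_measure.sigma_finite_iff_density_finite[OF sigma_finite_lborel]) auto

interpretation nlborel: sigma_finite_measure nlborel
  by (rule sigma_finite_nlborel)

interpretation nlborel_pair: pair_sigma_finite nlborel nlborel ..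

text \<open>The exponents \<open>DIM / 2\<close> add up over the factors, so the normalization
  survives the splitting of space into blocks. Every Fubini argument below rests on this.\<close>

lemma nlborel_prod:
  "nlborel \<Otimes>\<^sub>M nlborel = (nlborel :: ('a::euclidean_space \<times> 'b::euclidean_space) measure)"
proof -
  have "ennreal (1 / (2 * pi) powr (real DIM('a) / 2)) * ennreal (1 / (2 * pi) powr (real DIM('b) / 2))
      = ennreal (1 / (2 * pi) powr (real DIM('a \<times> 'b) / 2))"
    by (simp add: ennreal_mult[symmetric] powr_add[symmetric] add_divide_distrib)
  then show ?thesis
    unfolding nlborel_def
    by (subst pair_measure_density)
       (use sigma_finite_nlborel in \<open>auto simp: nlborel_def lborel_prod sigma_finite_lborel split_beta'\<close>)
qed

lemma nn_integral_nlborel_fst: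
  fixes f :: "'a::euclidean_space \<times> 'b::euclidean_space \<Rightarrow> ennreal"
  assumes "f \<in> borel_measurable borel"
  shows "(\<integral>\<^sup>+z. f z \<partial>nlborel) = (\<integral>\<^sup>+x. \<integral>\<^sup>+y. f (x, y) \<partial>nlborel \<partial>nlborel)"
  using assms
  by (subst nlborel.nn_integral_fst) (simp_all add: nlborel_prod)

lemma nn_integral_nlborel_swap:
  fixes f :: "'a::euclidean_space \<Rightarrow> 'b::euclidean_space \<Rightarrow> ennreal"
  assumes "(\<lambda>(x, y). f x y) \<in> borel_measurable borel"
  shows "(\<integral>\<^sup>+x. \<integral>\<^sup>+y. f x y \<partial>nlborel \<partial>nlborel) = (\<integral>\<^sup>+y. \<integral>\<^sup>+x. f x y \<partial>nlborel \<partial>nlborel)"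
  using nlborel_pair.Fubini'[of f] assms by (simp add: borel_prod[symmetric] cong: measurable_cong_sets)

lemma nn_integral_nlborel_affine:
  fixes f :: "'a::euclidean_space \<Rightarrow> ennreal"
  assumes [measurable]: "f \<in> borel_measurable borel" and "c \<noteq> 0"
  shows "ennreal (\<bar>c\<bar> ^ DIM('a)) * (\<integral>\<^sup>+x. f (t + c *\<^sub>R x) \<partial>nlborel) = (\<integral>\<^sup>+x. f x \<partial>nlborel)"
proof -
  have "(\<integral>\<^sup>+x. f x \<partial>lborel) = ennreal (\<bar>c\<bar> ^ DIM('a)) * (\<integral>\<^sup>+x. f (t + c *\<^sub>R x) \<partial>lborel)"
    by (subst lborel_affine[OF \<open>c \<noteq> 0\<close>, of t])
       (simp add: nn_integral_density nn_integral_distr nn_integral_cmult)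
  then show ?thesis
    by (simp add: nn_integral_nlborel mult.left_commute)
qed

lemma nn_integral_nlborel_plus:
  fixes f :: "'a::euclidean_space \<Rightarrow> ennreal"
  assumes "f \<in> borel_measurable borel"
  shows "(\<integral>\<^sup>+x. f (t + x) \<partial>nlborel) = (\<integral>\<^sup>+x. f x \<partial>nlborel)"
  using nn_integral_nlborel_affine[OF assms, of 1 t] by simp

lemma nn_integral_nlborel_minus:
  fixes f :: "'a::euclidean_space \<Rightarrow> ennreal"
  assumes "f \<in> borel_measurable borel"
  shows "(\<integral>\<^sup>+x. f (t - x) \<partial>nlborel) = (\<integral>\<^sup>+x. f x \<partial>nlborel)"
  using nn_integral_nlborel_affine[OF assms, of "-1" t] by simp

lemma distr_nlborel_plus: "distr nlborel borel (\<lambda>x. t + x) = (nlborel :: 'a::euclidean_space measure)"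
proof (rule measure_eqI)
  fix A assume "A \<in> sets (distr nlborel borel (\<lambda>x. t + x))"
  then have [measurable]: "A \<in> sets borel" by simp
  have "emeasure (distr nlborel borel (\<lambda>x. t + x)) A = (\<integral>\<^sup>+x. indicator A x \<partial>distr nlborel borel (\<lambda>x. t + x))"
    by simp
  also have "\<dots> = (\<integral>\<^sup>+x. indicator A (t + x) \<partial>nlborel)"
    by (subst nn_integral_distr) auto
  also have "\<dots> = (\<integral>\<^sup>+x. indicator A x \<partial>nlborel)"
    by (rule nn_integral_nlborel_plus) simp
  finally show "emeasure (distr nlborel borel (\<lambda>x. t + x)) A = emeasure nlborel A" by simp
qed simp

lemma integral_nlborel_plus:
  fixes f :: "'a::euclidean_space \<Rightarrow> 'b::{banach, second_countable_topology}"
  assumes [measurable]: "f \<in> borel_measurable borel"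
  shows "(\<integral>x. f (t + x) \<partial>nlborel) = (\<integral>x. f x \<partial>nlborel)"
  using integral_distr[of "\<lambda>x. t + x" nlborel borel f] by (simp add: distr_nlborel_plus)

text \<open>Serves to take the root of a squared Cauchy-Schwarz inequality without a finiteness
  assumption.\<close>

lemma ennreal_power2_le_iff: "(x::ennreal)\<^sup>2 \<le> y\<^sup>2 \<longleftrightarrow> x \<le> y"
proof
  assume *: "x\<^sup>2 \<le> y\<^sup>2"
  show "x \<le> y"
  proof (cases y)
    case (real b)
    show ?thesis
    proof (cases x)
      case (real a)
      with * \<open>y = ennreal b\<close> \<open>0 \<le> b\<close> show ?thesis
        by (simp add: ennreal_power power2_le_iff_abs_le)
    next
      case top
      with * real show ?thesis
        by (simp add: ennreal_power power2_eq_square top_unique ennreal_mult[symmetric])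
    qed
  next
    case top
    then show ?thesis by simp
  qed
qed (rule power_mono_ennreal)

section \<open>Gaussians\<close>

lemma cis_borel_measurable [measurable]: "cis \<in> borel_measurable borel"
  by (intro borel_measurable_continuous_onI continuous_on_cis continuous_on_id)

lemma of_real_borel_measurable [measurable]: "complex_of_real \<in> borel_measurable borel"
  by (intro borel_measurable_continuous_onI continuous_intros)

text \<open>This is the characteristic function of the standard normal distribution, freed of its
  normalization \<open>1 / sqrt (2 * pi)\<close>.\<close>

lemma gauss_fourier_real:
  shows "(\<integral>x. cis (x * t) * of_real (exp (- x\<^sup>2 / 2)) \<partial>lborel) = of_real (sqrt (2 * pi) * exp (- t\<^sup>2 / 2))"
    and "integrable lborel (\<lambda>x. cis (x * t) * of_real (exp (- x\<^sup>2 / 2)))"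
proof -
  have "char std_normal_distribution t = (\<integral>x. std_normal_density x *\<^sub>R iexp (t * x) \<partial>lborel)"
    unfolding char_def by (subst integral_density) auto
  also have "\<dots> = (\<integral>x. of_real (1 / sqrt (2 * pi)) * (cis (x * t) * of_real (exp (- x\<^sup>2 / 2))) \<partial>lborel)"
    by (intro Bochner_Integration.integral_cong)
       (simp_all add: std_normal_density_def cis_conv_exp scaleR_conv_of_real mult_ac)
  also have "\<dots> = of_real (1 / sqrt (2 * pi)) * (\<integral>x. (cis (x * t) * of_real (exp (- x\<^sup>2 / 2))) \<partial>lborel)"
    by simp
  finally have "of_real (1 / sqrt (2 * pi)) * (\<integral>x. (cis (x * t) * of_real (exp (- x\<^sup>2 / 2))) \<partial>lborel)
      = complex_of_real (exp (- t\<^sup>2 / 2))"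
    by (simp add: char_std_normal_distribution)
  then show "(\<integral>x. cis (x * t) * of_real (exp (- x\<^sup>2 / 2)) \<partial>lborel) = of_real (sqrt (2 * pi) * exp (- t\<^sup>2 / 2))"
    by (simp add: field_simps)
  have "integrable lborel (\<lambda>x. sqrt (2 * pi) * std_normal_density x)"
    by simp
  then show "integrable lborel (\<lambda>x. cis (x * t) * of_real (exp (- x\<^sup>2 / 2)))"
    by (rule Bochner_Integration.integrable_bound)
       (auto simp: std_normal_density_def norm_mult)
qed

text \<open>Both the character and the Gaussian factor over the coordinates in \<open>Basis\<close>,
  so the integral is a product of one-dimensional ones.\<close>

lemma gauss_fourier_lborel:
  fixes a :: "'a::euclidean_space"
  shows "(\<integral>w. cis (w \<bullet> a) * of_real (exp (- (norm w)\<^sup>2 / 2)) \<partial>lborel)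
      = of_real ((2 * pi) powr (real DIM('a) / 2) * exp (- (norm a)\<^sup>2 / 2))" (is ?int)
    and "integrable lborel (\<lambda>w. cis (w \<bullet> a) * of_real (exp (- (norm w)\<^sup>2 / 2)))" (is ?ible)
proof -
  interpret product_sigma_finite "\<lambda>_::'a. lborel :: real measure" ..
  define F where "F w = cis (w \<bullet> a) * of_real (exp (- (norm w)\<^sup>2 / 2))" for w :: 'a
  let ?s = "\<lambda>f::'a \<Rightarrow> real. \<Sum>b\<in>Basis. f b *\<^sub>R b"
  have [measurable]: "F \<in> borel_measurable borel" unfolding F_def by measurable
  have F: "F (?s f) = (\<Prod>b\<in>Basis. cis (f b * (a \<bullet> b)) * of_real (exp (- (f b)\<^sup>2 / 2)))" for f
  proof -
    have "(norm (?s f))\<^sup>2 = (\<Sum>b\<in>Basis. (f b)\<^sup>2)"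
      unfolding power2_norm_eq_inner by (subst euclidean_inner) (simp add: power2_eq_square)
    moreover have "?s f \<bullet> a = (\<Sum>b\<in>Basis. f b * (a \<bullet> b))"
      by (simp add: inner_sum_left) (simp add: inner_commute)
    moreover have "exp (- (\<Sum>b\<in>Basis. (f b)\<^sup>2) / 2) = (\<Prod>b\<in>Basis. exp (- (f b)\<^sup>2 / 2))"
      by (simp add: exp_sum[symmetric] sum_negf sum_divide_distrib)
    moreover have "cis (\<Sum>b\<in>Basis. f b * (a \<bullet> b)) = (\<Prod>b\<in>Basis. cis (f b * (a \<bullet> b)))"
      by (simp add: cis_conv_exp exp_sum sum_distrib_left)
    ultimately show ?thesis
      unfolding F_def prod.distrib by (simp only: of_real_prod)
  qed
  have "(\<integral>w. F w \<partial>lborel) = (\<integral>f. F (?s f) \<partial>(\<Pi>\<^sub>M b\<in>Basis. lborel))"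
    by (subst lborel_eq) (subst integral_distr, auto)
  also have "\<dots> = (\<Prod>b\<in>Basis. \<integral>x. cis (x * (a \<bullet> b)) * of_real (exp (- x\<^sup>2 / 2)) \<partial>lborel)"
    unfolding F by (intro product_integral_prod gauss_fourier_real(2)) simp
  also have "\<dots> = of_real (\<Prod>b\<in>Basis. sqrt (2 * pi) * exp (- (a \<bullet> b)\<^sup>2 / 2))"
    unfolding gauss_fourier_real by simp
  also have "(\<Prod>b\<in>Basis. sqrt (2 * pi) * exp (- (a \<bullet> b)\<^sup>2 / 2)) =
      (2 * pi) powr (real DIM('a) / 2) * exp (- (norm a)\<^sup>2 / 2)"
  proof -
    have "(norm a)\<^sup>2 = (\<Sum>b\<in>Basis. (a \<bullet> b)\<^sup>2)"
      unfolding power2_norm_eq_inner by (subst euclidean_inner) (simp add: power2_eq_square)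
    moreover have "sqrt (2 * pi) ^ DIM('a) = (2 * pi) powr (real DIM('a) / 2)"
      by (simp add: powr_half_sqrt[symmetric] powr_realpow[symmetric] powr_powr)
    ultimately show ?thesis
      by (simp add: prod.distrib exp_sum[symmetric] sum_negf sum_divide_distrib)
  qed
  finally show ?int by (simp add: F_def)
  have "integrable (\<Pi>\<^sub>M b\<in>Basis. lborel) (\<lambda>f. F (?s f))"
    unfolding F by (intro product_integrable_prod gauss_fourier_real(2)) simp
  then have "integrable (distr (\<Pi>\<^sub>M b\<in>Basis. lborel) borel ?s) F"
    by (subst integrable_distr_eq) auto
  then show ?ible
    by (subst lborel_eq) (simp add: F_def[abs_def])
qed

text \<open>The Fourier transform of \<open>exp (- (\<sigma> * norm w)\<^sup>2 / 2)\<close> with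
  respect to \<open>nlborel\<close>. It is an approximate identity of mass 1 as
  \<open>\<sigma>\<close> tends to 0.\<close>

definition gauss :: "real \<Rightarrow> 'a::euclidean_space \<Rightarrow> real" where
  "gauss \<sigma> a = exp (- (norm a / \<sigma>)\<^sup>2 / 2) / \<sigma> ^ DIM('a)"

lemma gauss_measurable [measurable]: "gauss \<sigma> \<in> borel_measurable borel"
  unfolding gauss_def by measurable

lemma gauss_nonneg: "\<sigma> > 0 \<Longrightarrow> gauss \<sigma> a \<ge> 0"
  by (simp add: gauss_def)

lemma integral_nlborel:
  fixes f :: "'a::euclidean_space \<Rightarrow> 'b::{banach, second_countable_topology}"
  assumes [measurable]: "f \<in> borel_measurable borel"
  shows "(\<integral>x. f x \<partial>nlborel) = (1 / (2 * pi) powr (real DIM('a) / 2)) *\<^sub>R (\<integral>x. f x \<partial>lborel)"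
  unfolding nlborel_def by (subst integral_density) auto

lemma integrable_scaleR_const_iff:
  fixes f :: "'a \<Rightarrow> 'b::{banach, second_countable_topology}"
  assumes "c \<noteq> 0"
  shows "integrable M (\<lambda>x. c *\<^sub>R f x) \<longleftrightarrow> integrable M f"
  using integrable_scaleR_right[of "inverse c" M "\<lambda>x. c *\<^sub>R f x"] assms by auto

lemma integrable_nlborel_iff:
  fixes f :: "'a::euclidean_space \<Rightarrow> 'b::{banach, second_countable_topology}"
  assumes [measurable]: "f \<in> borel_measurable borel"
  shows "integrable nlborel f \<longleftrightarrow> integrable lborel f"
  unfolding nlborel_def by (subst integrable_density) (auto simp: integrable_scaleR_const_iff)

lemma integrable_nlborel_affine:
  fixes f :: "'a::euclidean_space \<Rightarrow> 'b::{banach, second_countable_topology}"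
  assumes f: "integrable nlborel f" and "c \<noteq> 0"
  shows "integrable nlborel (\<lambda>x. f (t + c *\<^sub>R x))"
proof -
  have [measurable]: "f \<in> borel_measurable borel"
    using borel_measurable_integrable[OF f] by simp
  have "integrable lborel f"
    using f by (simp add: integrable_nlborel_iff)
  then have "integrable (density (distr lborel borel (\<lambda>x. t + c *\<^sub>R x)) (\<lambda>_. ennreal (\<bar>c\<bar> ^ DIM('a)))) f"
    by (simp only: lborel_affine[OF \<open>c \<noteq> 0\<close>, of t, symmetric])
  then have "integrable lborel (\<lambda>x. \<bar>c\<bar> ^ DIM('a) *\<^sub>R f (t + c *\<^sub>R x))"
    by (subst (asm) integrable_density; (subst (asm) integrable_distr_eq)?) auto
  then show ?thesis
    using \<open>c \<noteq> 0\<close> by (simp add: integrable_nlborel_iff integrable_scaleR_const_iff)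
qed

lemma integral_nlborel_affine:
  fixes f :: "'a::euclidean_space \<Rightarrow> 'b::{banach, second_countable_topology}"
  assumes [measurable]: "f \<in> borel_measurable borel" and "c \<noteq> 0"
  shows "(\<bar>c\<bar> ^ DIM('a)) *\<^sub>R (\<integral>x. f (t + c *\<^sub>R x) \<partial>nlborel) = (\<integral>x. f x \<partial>nlborel)"
proof -
  have "(\<integral>x. f x \<partial>lborel) = (\<bar>c\<bar> ^ DIM('a)) *\<^sub>R (\<integral>x. f (t + c *\<^sub>R x) \<partial>lborel)"
    by (subst lborel_affine[OF \<open>c \<noteq> 0\<close>, of t])
       (simp add: integral_density integral_distr)
  then show ?thesis
    by (simp add: integral_nlborel)
qed

lemma gauss_fourier:
  fixes a :: "'a::euclidean_space"
  assumes "\<sigma> > 0"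
  shows "(\<integral>w. cis (w \<bullet> a) * of_real (exp (- (\<sigma> * norm w)\<^sup>2 / 2)) \<partial>nlborel) = of_real (gauss \<sigma> a)" (is ?int)
    and "integrable nlborel (\<lambda>w. cis (w \<bullet> a) * of_real (exp (- (\<sigma> * norm w)\<^sup>2 / 2)))" (is ?ible)
proof -
  define F where "F w = cis (w \<bullet> (a /\<^sub>R \<sigma>)) * of_real (exp (- (norm w)\<^sup>2 / 2))" for w :: 'a
  have [measurable]: "F \<in> borel_measurable borel" unfolding F_def by measurable
  have F: "F (0 + \<sigma> *\<^sub>R w) = cis (w \<bullet> a) * of_real (exp (- (\<sigma> * norm w)\<^sup>2 / 2))" for w
    using assms by (simp add: F_def field_simps)
  have "integrable nlborel F"
    using gauss_fourier_lborel(2)[of "a /\<^sub>R \<sigma>"] by (simp add: integrable_nlborel_iff F_def[abs_def])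
  from integrable_nlborel_affine[OF this, of \<sigma> 0] assms show ?ible
    by (simp only: F)
  have "\<sigma> ^ DIM('a) *\<^sub>R (\<integral>w. cis (w \<bullet> a) * of_real (exp (- (\<sigma> * norm w)\<^sup>2 / 2)) \<partial>nlborel) = (\<integral>w. F w \<partial>nlborel)"
    using integral_nlborel_affine[of F \<sigma> 0] assms unfolding F by simp
  also have "\<dots> = of_real (exp (- (norm (a /\<^sub>R \<sigma>))\<^sup>2 / 2))"
    unfolding integral_nlborel[OF \<open>F \<in> borel_measurable borel\<close>]
    unfolding F_def gauss_fourier_lborel(1) by (simp add: scaleR_conv_of_real)
  also have "norm (a /\<^sub>R \<sigma>) = norm a / \<sigma>"
    using assms by (simp add: divide_inverse)
  finally show ?int
    using assms by (simp add: gauss_def scaleR_conv_of_real field_simps)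
qed

text \<open>The integral of the standard Gaussian is the value of its transform at \<open>0\<close>,
  namely 1; dilation by \<open>1 / \<sigma>\<close> produces exactly the denominator
  \<open>\<sigma> ^ DIM('a)\<close>.\<close>

lemma nn_integral_gauss:
  assumes "\<sigma> > 0"
  shows "(\<integral>\<^sup>+a. ennreal (gauss \<sigma> a) \<partial>(nlborel :: 'a::euclidean_space measure)) = 1"
proof -
  define G where "G w = exp (- (norm w)\<^sup>2 / 2)" for w :: 'a
  have G: "G = (\<lambda>w. exp (- (norm w)\<^sup>2 / 2))" by (simp add: fun_eq_iff G_def)
  have G_nonneg: "G w \<ge> 0" for w by (simp add: G_def)
  have [measurable]: "G \<in> borel_measurable borel" unfolding G_def by measurable
  have 1: "integrable nlborel (\<lambda>w. complex_of_real (G w))"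
    using gauss_fourier(2)[of 1 "0::'a"] by (simp add: G_def[abs_def])
  then have i: "integrable nlborel (\<lambda>w. G w)"
    by (simp only: complex_of_real_integrable_eq)
  have "(\<integral>w. complex_of_real (G w) \<partial>nlborel) = 1"
    using gauss_fourier(1)[of 1 "0::'a"] by (simp add: gauss_def G)
  then have "complex_of_real (\<integral>w. G w \<partial>nlborel) = complex_of_real 1"
    by (simp only: integral_complex_of_real of_real_1)
  then have "(\<integral>w. G w \<partial>nlborel) = 1"
    unfolding of_real_eq_iff .
  then have "(\<integral>\<^sup>+w. ennreal (G w) \<partial>nlborel) = 1"
    by (subst nn_integral_eq_integral[OF i]) (auto simp: G_nonneg)
  moreover have "ennreal (\<bar>1 / \<sigma>\<bar> ^ DIM('a)) * (\<integral>\<^sup>+w. ennreal (G (0 + (1 / \<sigma>) *\<^sub>R w)) \<partial>nlborel)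
      = (\<integral>\<^sup>+w. ennreal (G w) \<partial>nlborel)"
    using assms by (intro nn_integral_nlborel_affine) auto
  ultimately have "(\<integral>\<^sup>+w. ennreal (\<bar>1 / \<sigma>\<bar> ^ DIM('a)) * ennreal (G (0 + (1 / \<sigma>) *\<^sub>R w)) \<partial>nlborel) = 1"
    by (subst nn_integral_cmult) auto
  moreover have "ennreal (\<bar>1 / \<sigma>\<bar> ^ DIM('a)) * ennreal (G (0 + (1 / \<sigma>) *\<^sub>R w)) = ennreal (gauss \<sigma> w)" for w
  proof -
    have "norm (0 + (1 / \<sigma>) *\<^sub>R w) = norm w / \<sigma>"
      using assms by simp
    moreover have "\<bar>1 / \<sigma>\<bar> ^ DIM('a) = 1 / \<sigma> ^ DIM('a)"
      using assms by (simp add: power_one_over)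
    ultimately show ?thesis
      using assms unfolding gauss_def G_def by (simp add: ennreal_mult[symmetric])
  qed
  ultimately show ?thesis
    by simp
qed

section \<open>Continuity of translations\<close>

text \<open>Triangle inequality through \<open>v\<close>; by translation invariance the translated
  error equals the untranslated one, hence the factor 2. It shows that continuity of translations is
  stable under approximation in the mean.\<close>

lemma L1_translation_approx:
  fixes u v :: "'a::euclidean_space \<Rightarrow> real"
  assumes [measurable]: "u \<in> borel_measurable borel" "v \<in> borel_measurable borel"
  shows "(\<integral>\<^sup>+x. ennreal \<bar>u (a + x) - u x\<bar> \<partial>nlborel)
    \<le> 2 * (\<integral>\<^sup>+x. ennreal \<bar>u x - v x\<bar> \<partial>nlborel) + (\<integral>\<^sup>+x. ennreal \<bar>v (a + x) - v x\<bar> \<partial>nlborel)"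
proof -
  have "(\<integral>\<^sup>+x. ennreal \<bar>u (a + x) - u x\<bar> \<partial>nlborel)
    \<le> (\<integral>\<^sup>+x. ennreal \<bar>u (a + x) - v (a + x)\<bar> + ennreal \<bar>u x - v x\<bar> + ennreal \<bar>v (a + x) - v x\<bar> \<partial>nlborel)"
    by (intro nn_integral_mono) (auto simp flip: ennreal_plus intro!: ennreal_leI)
  also have "\<dots> = (\<integral>\<^sup>+x. ennreal \<bar>u (a + x) - v (a + x)\<bar> \<partial>nlborel) + (\<integral>\<^sup>+x. ennreal \<bar>u x - v x\<bar> \<partial>nlborel)
      + (\<integral>\<^sup>+x. ennreal \<bar>v (a + x) - v x\<bar> \<partial>nlborel)"
    by (simp add: nn_integral_add)
  also have "(\<integral>\<^sup>+x. ennreal \<bar>u (a + x) - v (a + x)\<bar> \<partial>nlborel) = (\<integral>\<^sup>+x. ennreal \<bar>u x - v x\<bar> \<partial>nlborel)"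
    by (rule nn_integral_nlborel_plus) simp
  finally show ?thesis
    by (simp add: mult_2)
qed

text \<open>For \<open>x\<close> in an open \<open>U\<close> the points \<open>a n + x\<close> are
  eventually in \<open>U\<close>, so the part of \<open>U\<close> that is moved out vanishes in the
  limit by dominated convergence. The part that is moved in is the same quantity for the opposite
  translation.\<close>

lemma L1_translation_open:
  fixes U :: "'a::euclidean_space set"
  assumes U: "open U" and fin: "emeasure nlborel U < \<infinity>" and a: "a \<longlonglongrightarrow> 0"
  shows "(\<lambda>n. \<integral>\<^sup>+x. ennreal \<bar>indicator U (a n + x) - indicator U x\<bar> \<partial>nlborel) \<longlonglongrightarrow> 0"
proof -
  have [measurable]: "U \<in> sets borel" using U by simp
  define J where "J b = (\<integral>\<^sup>+x. indicator U x * indicator (- U) (b + x) \<partial>nlborel)" for b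
  have J: "(\<lambda>n. J (b n)) \<longlonglongrightarrow> 0" if b: "b \<longlonglongrightarrow> 0" for b
  proof -
    have "(\<lambda>n. J (b n)) \<longlonglongrightarrow> integral\<^sup>N (nlborel :: 'a measure) (\<lambda>_. 0)"
      unfolding J_def
    proof (rule nn_integral_dominated_convergence[where w = "indicator U"])
      show "AE x in nlborel. (\<lambda>n. indicator U x * indicator (- U) (b n + x) :: ennreal) \<longlonglongrightarrow> 0"
      proof (intro AE_I2 tendsto_eventually)
        fix x
        have "(\<lambda>n. b n + x) \<longlonglongrightarrow> 0 + x"
          by (intro tendsto_add b tendsto_const)
        then have "\<forall>\<^sub>F n in sequentially. b n + x \<in> U" if "x \<in> U"
          using U that by (auto dest: topological_tendstoD)
        then show "\<forall>\<^sub>F n in sequentially. indicator U x * indicator (- U) (b n + x) = (0::ennreal)"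
          by (cases "x \<in> U") (auto elim!: eventually_mono)
      qed
    qed (use fin in \<open>auto split: split_indicator\<close>)
    then show ?thesis by simp
  qed
  have "(\<integral>\<^sup>+x. ennreal \<bar>indicator U (b + x) - indicator U x\<bar> \<partial>nlborel) = J b + J (- b)" for b
  proof -
    have "(\<integral>\<^sup>+x. ennreal \<bar>indicator U (b + x) - indicator U x\<bar> \<partial>nlborel)
        = (\<integral>\<^sup>+x. indicator U x * indicator (- U) (b + x) + indicator U (b + x) * indicator (- U) x \<partial>nlborel)"
      by (intro nn_integral_cong) (auto simp: indicator_def)
    also have "\<dots> = J b + (\<integral>\<^sup>+x. indicator U (b + x) * indicator (- U) x \<partial>nlborel)"
      unfolding J_def by (simp add: nn_integral_add)
    also have "(\<integral>\<^sup>+x. indicator U (b + x) * indicator (- U) x \<partial>nlborel)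
        = (\<integral>\<^sup>+x. indicator U (b + x) * indicator (- U) (- b + (b + x)) \<partial>nlborel)"
      by simp
    also have "\<dots> = J (- b)"
      unfolding J_def by (rule nn_integral_nlborel_plus) simp
    finally show ?thesis .
  qed
  moreover have "(\<lambda>n. J (a n) + J (- a n)) \<longlonglongrightarrow> 0 + 0"
    using a by (intro tendsto_add J) (auto intro: tendsto_eq_intros)
  ultimately show ?thesis by simp
qed

lemma emeasure_nlborel_le:
  fixes A :: "'a::euclidean_space set"
  assumes A: "A \<in> sets borel"
  shows "emeasure nlborel A \<le> emeasure lborel A"
proof -
  have "1 / (2 * pi) powr (real DIM('a) / 2) \<le> 1"
    using pi_gt3 by (simp add: ge_one_powr_ge_zero)
  then have "ennreal (1 / (2 * pi) powr (real DIM('a) / 2)) * emeasure lborel A \<le> 1 * emeasure lborel A"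
    by (intro mult_right_mono) (simp_all add: ennreal_le_1)
  then show ?thesis
    using nn_integral_nlborel[of "indicator A :: 'a \<Rightarrow> _"] A by simp
qed

text \<open>Outer regularity passes from open sets to Borel sets of finite measure, and the
  induction rule for integrable functions does the rest. The local fact \<open>approx\<close> closes
  the class under approximation in the mean and is used both for sets and for limits.\<close>

lemma L1_translation:
  fixes u :: "'a::euclidean_space \<Rightarrow> real"
  assumes u: "integrable nlborel u" and a: "a \<longlonglongrightarrow> 0"
  shows "(\<lambda>n. \<integral>\<^sup>+x. ennreal \<bar>u (a n + x) - u x\<bar> \<partial>nlborel) \<longlonglongrightarrow> 0"
proof -
  let ?\<tau> = "\<lambda>u n. \<integral>\<^sup>+x. ennreal \<bar>u (a n + x) - u x\<bar> \<partial>nlborel"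
  have approx: "?\<tau> u \<longlonglongrightarrow> 0"
    if [measurable]: "u \<in> borel_measurable borel"
      and v: "\<And>e::real. e > 0 \<Longrightarrow> \<exists>v. v \<in> borel_measurable borel \<and> ?\<tau> v \<longlonglongrightarrow> 0 \<and>
        (\<integral>\<^sup>+x. ennreal \<bar>u x - v x\<bar> \<partial>nlborel) < ennreal e" for u
  proof (rule tendsto_zero_ennreal)
    fix e :: real assume "e > 0"
    obtain v where v: "v \<in> borel_measurable borel" "?\<tau> v \<longlonglongrightarrow> 0"
        "(\<integral>\<^sup>+x. ennreal \<bar>u x - v x\<bar> \<partial>nlborel) < ennreal (e / 4)"
      using v[of "e / 4"] \<open>e > 0\<close> by auto
    have "\<forall>\<^sub>F n in sequentially. ?\<tau> v n < ennreal (e / 2)"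
      using v(2) \<open>e > 0\<close> by (intro order_tendstoD(2)) auto
    then show "\<forall>\<^sub>F n in sequentially. ?\<tau> u n < ennreal e"
    proof eventually_elim
      case (elim n)
      have "?\<tau> u n \<le> 2 * (\<integral>\<^sup>+x. ennreal \<bar>u x - v x\<bar> \<partial>nlborel) + ?\<tau> v n"
        by (rule L1_translation_approx) (use v in auto)
      also have "\<dots> < 2 * ennreal (e / 4) + ennreal (e / 2)"
        by (intro add_strict_mono elim ennreal_mult_strict_left_mono v) auto
      also have "\<dots> = ennreal (2 * (e / 4)) + ennreal (e / 2)"
        using \<open>e > 0\<close> by (subst ennreal_mult) auto
      also have "\<dots> = ennreal e"
        using \<open>e > 0\<close> by (subst ennreal_plus[symmetric]) auto
      finally show ?case .
    qed
  qed
  have scale: "?\<tau> (\<lambda>x. u x * c) \<longlonglongrightarrow> 0" if [measurable]: "u \<in> borel_measurable borel" and u: "?\<tau> u \<longlonglongrightarrow> 0" for u and c :: real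
  proof -
    have "?\<tau> (\<lambda>x. u x * c) n = ennreal \<bar>c\<bar> * ?\<tau> u n" for n
      by (subst nn_integral_cmult[symmetric])
         (auto simp: ennreal_mult[symmetric] abs_mult[symmetric] algebra_simps intro!: nn_integral_cong)
    moreover have "(\<lambda>n. ennreal \<bar>c\<bar> * ?\<tau> u n) \<longlonglongrightarrow> ennreal \<bar>c\<bar> * 0"
      by (intro ennreal_tendsto_cmult u) auto
    ultimately show ?thesis by simp
  qed
  show ?thesis
    using u
  proof (induction rule: integrable_induct)
    case (base A c)
    then have [measurable]: "A \<in> sets borel" by simp
    have "?\<tau> (indicator A) \<longlonglongrightarrow> 0"
    proof (rule approx)
      fix e :: real assume "e > 0"
      obtain U where U: "open U" "A \<subseteq> U" "emeasure lborel (U - A) < e"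
        using outer_regular_lborel[OF _ \<open>e > 0\<close>, of A] by auto
      have [measurable]: "U \<in> sets borel" using U by simp
      have e: "emeasure nlborel (U - A) < e"
        using U(3) by (intro order_le_less_trans[OF emeasure_nlborel_le]) auto
      have "emeasure nlborel U \<le> emeasure nlborel A + emeasure nlborel (U - A)"
        using U by (subst plus_emeasure) (auto intro!: emeasure_mono)
      also have "\<dots> < \<infinity>"
        using base e by (auto simp: less_top[symmetric] top_unique)
      finally have "?\<tau> (indicator U) \<longlonglongrightarrow> 0"
        using U a by (intro L1_translation_open) auto
      moreover have "(\<integral>\<^sup>+x. ennreal \<bar>indicator A x - indicator U x\<bar> \<partial>nlborel) = (\<integral>\<^sup>+x. indicator (U - A) x \<partial>nlborel)"
        using U by (intro nn_integral_cong) (auto simp: indicator_def)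
      ultimately show "\<exists>v. v \<in> borel_measurable borel \<and> ?\<tau> v \<longlonglongrightarrow> 0 \<and>
          (\<integral>\<^sup>+x. ennreal \<bar>indicator A x - v x\<bar> \<partial>nlborel) < ennreal e"
        using e by (intro exI[of _ "indicator U"]) auto
    qed simp
    from scale[OF _ this, of c] show ?case by simp
  next
    case (add f g)
    have [measurable]: "f \<in> borel_measurable borel" "g \<in> borel_measurable borel"
      using add.hyps[THEN borel_measurable_integrable] by auto
    have lim: "(\<lambda>n. ?\<tau> f n + ?\<tau> g n) \<longlonglongrightarrow> 0"
      using tendsto_add[OF add.IH] by simp
    have le: "?\<tau> (\<lambda>x. f x + g x) n \<le> ?\<tau> f n + ?\<tau> g n" for n
    proof -
      have "?\<tau> (\<lambda>x. f x + g x) n \<le> (\<integral>\<^sup>+x. ennreal \<bar>f (a n + x) - f x\<bar> + ennreal \<bar>g (a n + x) - g x\<bar> \<partial>nlborel)"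
        by (intro nn_integral_mono) (auto simp flip: ennreal_plus intro!: ennreal_leI)
      also have "\<dots> = ?\<tau> f n + ?\<tau> g n"
        by (simp add: nn_integral_add)
      finally show ?thesis .
    qed
    show ?case
      by (rule tendsto_sandwich[OF _ _ tendsto_const lim]) (use le in auto)
  next
    case (lim f s)
    have [measurable]: "f \<in> borel_measurable borel" "\<And>i. s i \<in> borel_measurable borel"
      using lim.hyps(1,4)[THEN borel_measurable_integrable] by auto
    show ?case
    proof (rule approx)
      fix e :: real assume "e > 0"
      have "(\<lambda>i. \<integral>\<^sup>+x. ennreal \<bar>f x - s i x\<bar> \<partial>nlborel) \<longlonglongrightarrow> integral\<^sup>N (nlborel :: 'a measure) (\<lambda>_. 0)"
      proof (rule nn_integral_dominated_convergence[where w = "\<lambda>x. ennreal (3 * \<bar>f x\<bar>)"])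
        \<comment> \<open>The induction rule provides
          \<open>norm (s i x) \<le> 2 * norm (f x)\<close>, whence the constant 3.\<close>
        show "AE x in nlborel. ennreal \<bar>f x - s i x\<bar> \<le> ennreal (3 * \<bar>f x\<bar>)" for i
          using lim.hyps(3)[of _ i] by (intro AE_I2 ennreal_leI) (force simp: abs_if split: if_splits)
        show "(\<integral>\<^sup>+x. ennreal (3 * \<bar>f x\<bar>) \<partial>nlborel) < \<infinity>"
          using integrableD(2)[OF integrable_mult_right[OF integrable_abs[OF lim.hyps(4)], of 3]] 
          by (simp add: abs_mult less_top)
        show "AE x in nlborel. (\<lambda>i. ennreal \<bar>f x - s i x\<bar>) \<longlonglongrightarrow> 0"
          using lim.hyps(2) by (intro AE_I2) (auto simp flip: ennreal_0 intro!: tendsto_ennrealI tendsto_eq_intros)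
      qed auto
      then have "\<forall>\<^sub>F i in sequentially. (\<integral>\<^sup>+x. ennreal \<bar>f x - s i x\<bar> \<partial>nlborel) < ennreal e"
        using \<open>e > 0\<close> by (intro order_tendstoD(2)) auto
      then obtain i where "(\<integral>\<^sup>+x. ennreal \<bar>f x - s i x\<bar> \<partial>nlborel) < ennreal e"
        by (auto simp: eventually_sequentially)
      then show "\<exists>v. v \<in> borel_measurable borel \<and> ?\<tau> v \<longlonglongrightarrow> 0 \<and>
          (\<integral>\<^sup>+x. ennreal \<bar>f x - v x\<bar> \<partial>nlborel) < ennreal e"
        using lim.IH[of i] by (intro exI[of _ "s i"]) auto
    qed simp
  qed
qed

lemma borel_measurable_fst [measurable]: "fst \<in> borel_measurable borel"
  and borel_measurable_snd [measurable]: "snd \<in> borel_measurable borel"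
  by (intro borel_measurable_continuous_onI continuous_intros)+

text \<open>Since \<open>x |x|\<close> is integrable for square integrable \<open>x\<close>, this transfers continuity of translations
  from \<open>L\<^sup>1\<close> to \<open>L\<^sup>2\<close>.\<close>

lemma signed_square_ineq: "(x - y)\<^sup>2 \<le> 2 * \<bar>x * \<bar>x\<bar> - y * \<bar>y\<bar>\<bar>" for x y :: real
proof (induction x y rule: linorder_wlog)
  case (le x y)
  have "0 \<le> (x + y)\<^sup>2" "0 \<le> (x - y)\<^sup>2" by auto
  with le show ?case
  proof (cases "0 \<le> x"; cases "0 \<le> y")
    assume "0 \<le> x" "0 \<le> y"
    moreover have "x * (y - x) \<ge> 0" "x * x \<le> y * y" 
      using le \<open>0 \<le> x\<close> by (auto intro: mult_mono)
    ultimately show ?thesis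
      using mult_nonneg_nonneg[of y "y - x"] le by (simp add: power2_eq_square algebra_simps)
  next
    assume "\<not> 0 \<le> x" "\<not> 0 \<le> y"
    moreover have "(- y) * (y - x) \<ge> 0" "y * y \<le> x * x"
      using le \<open>\<not> 0 \<le> y\<close> mult_mono[of "- y" "- x" "- y" "- x"] by (auto intro: mult_nonneg_nonneg simp: mult_le_0_iff)
    ultimately show ?thesis
      \<comment> \<open>For negative \<open>x \<le> y\<close> the right side minus the left side is
        \<open>(x - y) * (x + 3 * y)\<close>.\<close>
      using mult_nonpos_nonpos[of "x - y" "x + 3 * y"] le by (simp add: power2_eq_square algebra_simps)
  next
    assume "\<not> 0 \<le> x" "0 \<le> y"
    then show ?thesis
      using \<open>0 \<le> (x + y)\<^sup>2\<close> by (simp add: power2_eq_square algebra_simps)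
  qed (use le in auto)
next
  case (sym x y)
  then show ?case by (simp add: power2_commute abs_minus_commute)
qed

lemma L2_translation:
  fixes F :: "'a::euclidean_space \<Rightarrow> complex"
  assumes [measurable]: "F \<in> borel_measurable borel"
    and fin: "integrable nlborel (\<lambda>x. (cmod (F x))\<^sup>2)" and a: "a \<longlonglongrightarrow> 0"
  shows "(\<lambda>n. \<integral>\<^sup>+x. ennreal ((cmod (F (a n + x) - F x))\<^sup>2) \<partial>nlborel) \<longlonglongrightarrow> 0"
proof -
  define u where "u x = Re (F x) * \<bar>Re (F x)\<bar>" for x
  define v where "v x = Im (F x) * \<bar>Im (F x)\<bar>" for x
  have [measurable]: "u \<in> borel_measurable borel" "v \<in> borel_measurable borel"
    unfolding u_def v_def by measurable
  have "integrable nlborel u"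
    using fin by (rule Bochner_Integration.integrable_bound)
       (auto simp: u_def abs_mult cmod_power2 simp flip: power2_eq_square)
  then have u: "(\<lambda>n. \<integral>\<^sup>+x. ennreal \<bar>u (a n + x) - u x\<bar> \<partial>nlborel) \<longlonglongrightarrow> 0"
    by (rule L1_translation[OF _ a])
  have "integrable nlborel v"
    using fin by (rule Bochner_Integration.integrable_bound)
       (auto simp: v_def abs_mult cmod_power2 simp flip: power2_eq_square)
  then have v: "(\<lambda>n. \<integral>\<^sup>+x. ennreal \<bar>v (a n + x) - v x\<bar> \<partial>nlborel) \<longlonglongrightarrow> 0"
    by (rule L1_translation[OF _ a])
  have lim: "(\<lambda>n. 2 * (\<integral>\<^sup>+x. ennreal \<bar>u (a n + x) - u x\<bar> \<partial>nlborel)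
      + 2 * (\<integral>\<^sup>+x. ennreal \<bar>v (a n + x) - v x\<bar> \<partial>nlborel)) \<longlonglongrightarrow> 2 * 0 + 2 * 0"
    by (intro tendsto_add ennreal_tendsto_cmult u v) auto
  have le: "(\<integral>\<^sup>+x. ennreal ((cmod (F (a n + x) - F x))\<^sup>2) \<partial>nlborel)
      \<le> 2 * (\<integral>\<^sup>+x. ennreal \<bar>u (a n + x) - u x\<bar> \<partial>nlborel)
      + 2 * (\<integral>\<^sup>+x. ennreal \<bar>v (a n + x) - v x\<bar> \<partial>nlborel)" for n
  proof -
    have "ennreal ((cmod (F (a n + x) - F x))\<^sup>2)
        \<le> 2 * ennreal \<bar>u (a n + x) - u x\<bar> + 2 * ennreal \<bar>v (a n + x) - v x\<bar>" for x
    proof -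
      have "(cmod (F (a n + x) - F x))\<^sup>2 \<le> 2 * \<bar>u (a n + x) - u x\<bar> + 2 * \<bar>v (a n + x) - v x\<bar>"
        unfolding cmod_power2 u_def v_def by (simp add: add_mono signed_square_ineq)
      then have "ennreal ((cmod (F (a n + x) - F x))\<^sup>2) \<le> ennreal (2 * \<bar>u (a n + x) - u x\<bar> + 2 * \<bar>v (a n + x) - v x\<bar>)"
        by (rule ennreal_leI)
      then show ?thesis
        by (simp add: ennreal_mult)
    qed
    then have "(\<integral>\<^sup>+x. ennreal ((cmod (F (a n + x) - F x))\<^sup>2) \<partial>nlborel)
      \<le> (\<integral>\<^sup>+x. 2 * ennreal \<bar>u (a n + x) - u x\<bar> + 2 * ennreal \<bar>v (a n + x) - v x\<bar> \<partial>nlborel)"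
      by (intro nn_integral_mono)
    also have "\<dots> = 2 * (\<integral>\<^sup>+x. ennreal \<bar>u (a n + x) - u x\<bar> \<partial>nlborel)
      + 2 * (\<integral>\<^sup>+x. ennreal \<bar>v (a n + x) - v x\<bar> \<partial>nlborel)"
      by (simp add: nn_integral_add nn_integral_cmult)
    finally show ?thesis .
  qed
  show ?thesis
    by (rule tendsto_sandwich[OF _ _ tendsto_const]) (use le lim in auto)
qed

section \<open>The Plancherel theorem\<close>

definition cfourier :: "('a::euclidean_space \<Rightarrow> complex) \<Rightarrow> 'a \<Rightarrow> complex" where
  "cfourier F w = (\<integral>t. cis (- (w \<bullet> t)) * F t \<partial>nlborel)"

lemma cfourier_measurable [measurable]:
  assumes [measurable]: "F \<in> borel_measurable borel"
  shows "cfourier F \<in> borel_measurable borel"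
proof -
  have "(\<lambda>w. \<integral>t. cis (- (w \<bullet> t)) * F t \<partial>nlborel) \<in> borel_measurable borel"
    by (rule nlborel.borel_measurable_lebesgue_integral) measurable
  then show ?thesis by (simp add: cfourier_def[abs_def])
qed

lemma integrable_nlborel_times:
  fixes F :: "'a::euclidean_space \<Rightarrow> 'c::{real_normed_algebra, banach, second_countable_topology}"
    and G :: "'b::euclidean_space \<Rightarrow> 'c"
  assumes F: "integrable nlborel F" and G: "integrable nlborel G"
  shows "integrable nlborel (\<lambda>p. F (fst p) * G (snd p))"
proof -
  have [measurable]: "F \<in> borel_measurable borel" "G \<in> borel_measurable borel"
    using F G by (auto dest: borel_measurable_integrable)
  have "(\<integral>\<^sup>+p. ennreal (norm (F (fst p) * G (snd p))) \<partial>nlborel)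
      \<le> (\<integral>\<^sup>+p. ennreal (norm (F (fst p))) * ennreal (norm (G (snd p))) \<partial>nlborel)"
    by (intro nn_integral_mono) (auto simp: ennreal_mult[symmetric] norm_mult_ineq intro!: ennreal_leI)
  also have "\<dots> = (\<integral>\<^sup>+x. ennreal (norm (F x)) \<partial>nlborel) * (\<integral>\<^sup>+y. ennreal (norm (G y)) \<partial>nlborel)"
    by (subst nn_integral_nlborel_fst) (simp_all add: nn_integral_cmult nn_integral_multc)
  also have "\<dots> < \<infinity>"
    using F G by (auto simp: integrable_iff_bounded ennreal_mult_less_top)
  finally show ?thesis
    by (intro integrableI_bounded) simp_all
qed

lemma nlborel_Fubini:
  fixes f :: "'a::euclidean_space \<times> 'b::euclidean_space \<Rightarrow> 'c::{banach, second_countable_topology}"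
  assumes "integrable nlborel f"
  shows "(\<integral>x. \<integral>y. f (x, y) \<partial>nlborel \<partial>nlborel) = (\<integral>z. f z \<partial>nlborel)"
    and "(\<integral>y. \<integral>x. f (x, y) \<partial>nlborel \<partial>nlborel) = (\<integral>z. f z \<partial>nlborel)"
    and "integrable nlborel (\<lambda>x. \<integral>y. f (x, y) \<partial>nlborel)"
    and "AE x in nlborel. integrable nlborel (\<lambda>y. f (x, y))"
proof -
  have *: "integrable (nlborel \<Otimes>\<^sub>M nlborel) f"
    using assms by (simp add: nlborel_prod)
  show "(\<integral>x. \<integral>y. f (x, y) \<partial>nlborel \<partial>nlborel) = (\<integral>z. f z \<partial>nlborel)"
    using nlborel_pair.integral_fst'[OF *] by (simp add: nlborel_prod)
  show "(\<integral>y. \<integral>x. f (x, y) \<partial>nlborel \<partial>nlborel) = (\<integral>z. f z \<partial>nlborel)"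
    using nlborel_pair.integral_snd[of "\<lambda>x y. f (x, y)"] * by (simp add: nlborel_prod)
  show "integrable nlborel (\<lambda>x. \<integral>y. f (x, y) \<partial>nlborel)"
    by (rule nlborel_pair.integrable_fst'[OF *])
  show "AE x in nlborel. integrable nlborel (\<lambda>y. f (x, y))"
    by (rule nlborel_pair.AE_integrable_fst'[OF *])
qed

lemma integral_nlborel_times:
  fixes F :: "'a::euclidean_space \<Rightarrow> complex" and G :: "'b::euclidean_space \<Rightarrow> complex"
  assumes F: "integrable nlborel F" and G: "integrable nlborel G"
  shows "(\<integral>p. F (fst p) * G (snd p) \<partial>nlborel) = (\<integral>x. F x \<partial>nlborel) * (\<integral>y. G y \<partial>nlborel)"
  using nlborel_Fubini(1)[OF integrable_nlborel_times[OF F G]] by simp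

lemma integrable_cis_times:
  fixes F :: "'a::euclidean_space \<Rightarrow> complex"
  assumes F: "integrable nlborel F"
  shows "integrable nlborel (\<lambda>t. cis (- (w \<bullet> t)) * F t)"
proof -
  have [measurable]: "F \<in> borel_measurable borel"
    using F by (auto dest: borel_measurable_integrable)
  show ?thesis
    using F by (rule Bochner_Integration.integrable_bound) (auto simp: norm_mult)
qed

text \<open>The squared modulus of the transform is a double integral. The Gaussian weight makes the
  triple integrand absolutely integrable, so Fubini applies before anything is known about square
  integrability of the transform. Integrating over \<open>w\<close> first turns the weight into the
  kernel \<open>gauss \<sigma>\<close>.\<close>

lemma plancherel_gauss:
  fixes F :: "'a::euclidean_space \<Rightarrow> complex"
  assumes F: "integrable nlborel F" and "\<sigma> > 0"
  shows "complex_of_real (\<integral>w. (cmod (cfourier F w))\<^sup>2 * exp (- (\<sigma> * norm w)\<^sup>2 / 2) \<partial>nlborel)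
      = (\<integral>p. of_real (gauss \<sigma> (snd p - fst p)) * (F (fst p) * cnj (F (snd p))) \<partial>nlborel)" (is ?eq)
    and "integrable nlborel (\<lambda>w. (cmod (cfourier F w))\<^sup>2 * exp (- (\<sigma> * norm w)\<^sup>2 / 2))" (is ?ible)
proof -
  have [measurable]: "F \<in> borel_measurable borel"
    using F by (auto dest: borel_measurable_integrable)
  define \<kappa> :: "'a \<Rightarrow> complex" where "\<kappa> w = of_real (exp (- (\<sigma> * norm w)\<^sup>2 / 2))" for w
  define K :: "'a \<times> 'a \<Rightarrow> complex" where "K p = F (fst p) * cnj (F (snd p))" for p
  define H where "H z = cis (fst z \<bullet> (snd (snd z) - fst (snd z))) * (\<kappa> (fst z) * K (snd z))" for z
  have cnjF: "integrable nlborel (\<lambda>x. cnj (F x))"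
    using F by simp
  have K: "integrable nlborel K"
    unfolding K_def by (rule integrable_nlborel_times[OF F cnjF])
  have \<kappa>: "integrable nlborel \<kappa>"
    using gauss_fourier(2)[OF \<open>\<sigma> > 0\<close>, of 0] by (simp add: \<kappa>_def[abs_def])
  have [measurable]: "\<kappa> \<in> borel_measurable borel" "K \<in> borel_measurable borel"
    using \<kappa> K by (auto dest: borel_measurable_integrable)
  have H: "integrable nlborel H"
    using integrable_nlborel_times[OF \<kappa> K]
  proof (rule Bochner_Integration.integrable_bound)
    show "H \<in> borel_measurable nlborel"
      unfolding H_def borel_measurable_nlborel by measurable
  qed (simp add: H_def norm_mult)
  have w: "(\<integral>p. H (w, p) \<partial>nlborel) = of_real ((cmod (cfourier F w))\<^sup>2 * exp (- (\<sigma> * norm w)\<^sup>2 / 2))" for w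
  proof -
    have "(\<integral>p. H (w, p) \<partial>nlborel)
        = (\<integral>p. \<kappa> w * ((cis (- (w \<bullet> fst p)) * F (fst p)) * cnj (cis (- (w \<bullet> snd p)) * F (snd p))) \<partial>nlborel)"
      by (intro Bochner_Integration.integral_cong) (auto simp: H_def K_def cis_cnj cis_mult inner_diff_right mult_ac)
    also have "\<dots> = \<kappa> w * (\<integral>p. (cis (- (w \<bullet> fst p)) * F (fst p)) * cnj (cis (- (w \<bullet> snd p)) * F (snd p)) \<partial>nlborel)"
      by (rule integral_mult_right_zero)
    also have "(\<integral>p. (cis (- (w \<bullet> fst p)) * F (fst p)) * cnj (cis (- (w \<bullet> snd p)) * F (snd p)) \<partial>nlborel)
        = cfourier F w * (\<integral>s. cnj (cis (- (w \<bullet> s)) * F s) \<partial>nlborel)"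
      unfolding cfourier_def
      by (rule integral_nlborel_times[OF integrable_cis_times[OF F] integrable_cnj[OF integrable_cis_times[OF F]]])
    also have "(\<integral>s. cnj (cis (- (w \<bullet> s)) * F s) \<partial>nlborel) = cnj (cfourier F w)"
      unfolding cfourier_def by (rule Bochner_Integration.integral_cnj)
    finally show ?thesis
      by (simp add: \<kappa>_def complex_mult_cnj cmod_power2 mult_ac)
  qed
  have p: "(\<integral>w. H (w, p) \<partial>nlborel) = of_real (gauss \<sigma> (snd p - fst p)) * K p" for p
  proof -
    have "(\<integral>w. H (w, p) \<partial>nlborel) = (\<integral>w. (cis (w \<bullet> (snd p - fst p)) * \<kappa> w) * K p \<partial>nlborel)"
      by (intro Bochner_Integration.integral_cong) (auto simp: H_def mult_ac)
    also have "\<dots> = (\<integral>w. (cis (w \<bullet> (snd p - fst p)) * \<kappa> w) \<partial>nlborel) * K p"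
      by (rule integral_mult_left_zero)
    finally show ?thesis
      unfolding \<kappa>_def gauss_fourier[OF \<open>\<sigma> > 0\<close>] .
  qed
  have "integrable nlborel (\<lambda>w. complex_of_real ((cmod (cfourier F w))\<^sup>2 * exp (- (\<sigma> * norm w)\<^sup>2 / 2)))"
    using nlborel_Fubini(3)[OF H] unfolding w .
  then show ?ible
    by (simp only: complex_of_real_integrable_eq)
  have "(\<integral>w. \<integral>p. H (w, p) \<partial>nlborel \<partial>nlborel) = (\<integral>p. \<integral>w. H (w, p) \<partial>nlborel \<partial>nlborel)"
    by (simp add: nlborel_Fubini[OF H])
  then show ?eq
    unfolding w p integral_complex_of_real K_def .
qed

lemma cnj_borel_measurable [measurable]: "cnj \<in> borel_measurable borel"
  by (intro borel_measurable_continuous_onI continuous_intros)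

text \<open>The integral is a Gaussian average of the squared distances \<open>D a\<close> between
  \<open>F\<close> and its translates. Substituting \<open>a = \<sigma> n *\<^sub>R y\<close> fixes
  the Gaussian and moves \<open>\<sigma> n\<close> into \<open>D\<close>, which is bounded by
  \<open>4 * S\<close> and tends to 0 by \<open>L2_translation\<close>.\<close>

lemma gauss_translation_tendsto:
  fixes F :: "'a::euclidean_space \<Rightarrow> complex"
  assumes [measurable]: "F \<in> borel_measurable borel"
    and fin: "integrable nlborel (\<lambda>x. (cmod (F x))\<^sup>2)"
    and \<sigma>: "\<sigma> \<longlonglongrightarrow> 0" "\<And>n. \<sigma> n > 0"
  shows "(\<lambda>n. \<integral>\<^sup>+p. ennreal (gauss (\<sigma> n) (snd p - fst p) * (cmod (F (fst p) - F (snd p)))\<^sup>2) \<partial>nlborel) \<longlonglongrightarrow> 0"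
proof -
  define D where "D a = (\<integral>\<^sup>+x. ennreal ((cmod (F (a + x) - F x))\<^sup>2) \<partial>nlborel)" for a
  have [measurable]: "D \<in> borel_measurable borel"
    unfolding D_def by measurable
  define S where "S = (\<integral>\<^sup>+x. ennreal ((cmod (F x))\<^sup>2) \<partial>nlborel)"
  have S: "S < \<infinity>"
    using fin by (simp add: S_def integrable_iff_bounded)
  have D_le: "D a \<le> 4 * S" for a
  proof -
    have "ennreal ((cmod (F (a + x) - F x))\<^sup>2) \<le> 2 * ennreal ((cmod (F (a + x)))\<^sup>2) + 2 * ennreal ((cmod (F x))\<^sup>2)" for x
    proof -
      have "(cmod (F (a + x) - F x))\<^sup>2 \<le> (cmod (F (a + x)) + cmod (F x))\<^sup>2"
        by (intro power_mono norm_triangle_ineq4) auto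
      also have "\<dots> \<le> 2 * (cmod (F (a + x)))\<^sup>2 + 2 * (cmod (F x))\<^sup>2"
        using sum_squares_bound[of "cmod (F (a + x))" "cmod (F x)"] by (simp add: power2_sum)
      finally have "ennreal ((cmod (F (a + x) - F x))\<^sup>2) \<le> ennreal (2 * (cmod (F (a + x)))\<^sup>2 + 2 * (cmod (F x))\<^sup>2)"
        by (rule ennreal_leI)
      then show ?thesis by (simp add: ennreal_mult)
    qed
    then have "D a \<le> (\<integral>\<^sup>+x. 2 * ennreal ((cmod (F (a + x)))\<^sup>2) + 2 * ennreal ((cmod (F x))\<^sup>2) \<partial>nlborel)"
      unfolding D_def by (intro nn_integral_mono)
    also have "\<dots> = 2 * (\<integral>\<^sup>+x. ennreal ((cmod (F (a + x)))\<^sup>2) \<partial>nlborel) + 2 * S"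
      by (simp add: nn_integral_add nn_integral_cmult S_def)
    also have "(\<integral>\<^sup>+x. ennreal ((cmod (F (a + x)))\<^sup>2) \<partial>nlborel) = S"
      unfolding S_def by (rule nn_integral_nlborel_plus) simp
    finally show ?thesis
      by (simp add: distrib_right[symmetric])
  qed
  have eq: "(\<integral>\<^sup>+p. ennreal (gauss s (snd p - fst p) * (cmod (F (fst p) - F (snd p)))\<^sup>2) \<partial>nlborel)
      = (\<integral>\<^sup>+y. ennreal (gauss 1 y) * D (s *\<^sub>R y) \<partial>nlborel)" if "s > 0" for s
  proof -
    have "(\<integral>\<^sup>+p. ennreal (gauss s (snd p - fst p) * (cmod (F (fst p) - F (snd p)))\<^sup>2) \<partial>nlborel)
        = (\<integral>\<^sup>+x. \<integral>\<^sup>+y. ennreal (gauss s (y - x) * (cmod (F x - F y))\<^sup>2) \<partial>nlborel \<partial>nlborel)"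
      by (subst nn_integral_nlborel_fst) simp_all
    also have "\<dots> = (\<integral>\<^sup>+x. \<integral>\<^sup>+a. ennreal (gauss s a * (cmod (F x - F (x + a)))\<^sup>2) \<partial>nlborel \<partial>nlborel)"
    proof (rule nn_integral_cong)
      fix x :: 'a
      show "(\<integral>\<^sup>+y. ennreal (gauss s (y - x) * (cmod (F x - F y))\<^sup>2) \<partial>nlborel)
          = (\<integral>\<^sup>+a. ennreal (gauss s a * (cmod (F x - F (x + a)))\<^sup>2) \<partial>nlborel)"
        using nn_integral_nlborel_plus[of "\<lambda>y. ennreal (gauss s (y - x) * (cmod (F x - F y))\<^sup>2)" x] by simp
    qed
    also have "\<dots> = (\<integral>\<^sup>+a. \<integral>\<^sup>+x. ennreal (gauss s a * (cmod (F x - F (x + a)))\<^sup>2) \<partial>nlborel \<partial>nlborel)"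
      by (rule nn_integral_nlborel_swap) simp
    also have "\<dots> = (\<integral>\<^sup>+a. ennreal (gauss s a) * D a \<partial>nlborel)"
      using that
      by (simp add: D_def nn_integral_cmult[symmetric] gauss_nonneg ennreal_mult norm_minus_commute add.commute)
    also have "\<dots> = ennreal (\<bar>s\<bar> ^ DIM('a)) * (\<integral>\<^sup>+y. ennreal (gauss s (0 + s *\<^sub>R y)) * D (0 + s *\<^sub>R y) \<partial>nlborel)"
      using that by (intro nn_integral_nlborel_affine[symmetric]) auto
    also have "\<dots> = (\<integral>\<^sup>+y. ennreal (\<bar>s\<bar> ^ DIM('a)) * (ennreal (gauss s (0 + s *\<^sub>R y)) * D (0 + s *\<^sub>R y)) \<partial>nlborel)"
      by (simp add: nn_integral_cmult)
    also have "\<dots> = (\<integral>\<^sup>+y. ennreal (gauss 1 y) * D (s *\<^sub>R y) \<partial>nlborel)"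
    proof (intro nn_integral_cong)
      fix y :: 'a
      have "\<bar>s\<bar> ^ DIM('a) * gauss s (0 + s *\<^sub>R y) = gauss 1 y"
        using that by (simp add: gauss_def)
      then have "ennreal (\<bar>s\<bar> ^ DIM('a)) * ennreal (gauss s (0 + s *\<^sub>R y)) = ennreal (gauss 1 y)"
        using that by (simp add: ennreal_mult[symmetric] gauss_nonneg)
      then show "ennreal (\<bar>s\<bar> ^ DIM('a)) * (ennreal (gauss s (0 + s *\<^sub>R y)) * D (0 + s *\<^sub>R y)) = ennreal (gauss 1 y) * D (s *\<^sub>R y)"
        by (simp add: mult.assoc[symmetric])
    qed
    finally show ?thesis .
  qed
  have "(\<lambda>n. \<integral>\<^sup>+y. ennreal (gauss 1 y) * D (\<sigma> n *\<^sub>R y) \<partial>nlborel) \<longlonglongrightarrow> integral\<^sup>N (nlborel :: 'a measure) (\<lambda>_. 0)"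
  proof (rule nn_integral_dominated_convergence[where w = "\<lambda>y. ennreal (gauss 1 y) * (4 * S)"])
    show "AE y in nlborel. ennreal (gauss 1 y) * D (\<sigma> n *\<^sub>R y) \<le> ennreal (gauss 1 y) * (4 * S)" for n
      by (intro AE_I2 mult_left_mono D_le) auto
    show "(\<integral>\<^sup>+y. ennreal (gauss 1 (y::'a)) * (4 * S) \<partial>nlborel) < \<infinity>"
      using S by (simp add: nn_integral_multc nn_integral_gauss ennreal_mult_less_top)
    show "AE y in nlborel. (\<lambda>n. ennreal (gauss 1 y) * D (\<sigma> n *\<^sub>R y)) \<longlonglongrightarrow> 0"
    proof (intro AE_I2)
      fix y :: 'a
      have "(\<lambda>n. \<sigma> n *\<^sub>R y) \<longlonglongrightarrow> 0 *\<^sub>R y"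
        by (intro tendsto_scaleR \<sigma> tendsto_const)
      then have "(\<lambda>n. D (\<sigma> n *\<^sub>R y)) \<longlonglongrightarrow> 0"
        unfolding D_def by (intro L2_translation fin) auto
      then have "(\<lambda>n. ennreal (gauss 1 y) * D (\<sigma> n *\<^sub>R y)) \<longlonglongrightarrow> ennreal (gauss 1 y) * 0"
        by (intro ennreal_tendsto_cmult) auto
      then show "(\<lambda>n. ennreal (gauss 1 y) * D (\<sigma> n *\<^sub>R y)) \<longlonglongrightarrow> 0" by simp
    qed
  qed simp_all
  then show ?thesis
    unfolding eq[OF \<sigma>(2)] by simp
qed

text \<open>Polarization: twice the real part of \<open>F x * cnj (F y)\<close> is the sum of the
  two squared moduli minus the squared modulus of the difference. Integrated against a kernel of
  mass 1 in either variable, the two squares give the right side. The identity is kept additive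
  because subtraction in \<open>ennreal\<close> is truncated.\<close>

lemma plancherel_gauss_identity:
  fixes F :: "'a::euclidean_space \<Rightarrow> complex"
  assumes F: "integrable nlborel F" and fin: "integrable nlborel (\<lambda>x. (cmod (F x))\<^sup>2)" and "\<sigma> > 0"
  shows "2 * (\<integral>\<^sup>+w. ennreal ((cmod (cfourier F w))\<^sup>2 * exp (- (\<sigma> * norm w)\<^sup>2 / 2)) \<partial>nlborel)
      + (\<integral>\<^sup>+p. ennreal (gauss \<sigma> (snd p - fst p) * (cmod (F (fst p) - F (snd p)))\<^sup>2) \<partial>nlborel)
      = 2 * (\<integral>\<^sup>+x. ennreal ((cmod (F x))\<^sup>2) \<partial>nlborel)"
proof -
  have [measurable]: "F \<in> borel_measurable borel"
    using F by (auto dest: borel_measurable_integrable)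
  define g where "g p = gauss \<sigma> (snd p - fst p)" for p :: "'a \<times> 'a"
  have [measurable]: "g \<in> borel_measurable borel" unfolding g_def by measurable
  have g: "g p \<ge> 0" for p using \<open>\<sigma> > 0\<close> by (simp add: g_def gauss_nonneg)
  define S where "S = (\<integral>x. (cmod (F x))\<^sup>2 \<partial>nlborel)"
  have S: "(\<integral>\<^sup>+x. ennreal ((cmod (F x))\<^sup>2) \<partial>nlborel) = ennreal S"
    unfolding S_def by (rule nn_integral_eq_integral[OF fin]) simp
  have "S \<ge> 0" by (simp add: S_def)
  have "(\<integral>\<^sup>+p. ennreal (g p * (cmod (F (fst p)))\<^sup>2) \<partial>nlborel) = ennreal S"
  proof -
    have "(\<integral>\<^sup>+p. ennreal (g p * (cmod (F (fst p)))\<^sup>2) \<partial>nlborel)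
      = (\<integral>\<^sup>+x. (\<integral>\<^sup>+y. ennreal (gauss \<sigma> (y - x)) \<partial>nlborel) * ennreal ((cmod (F x))\<^sup>2) \<partial>nlborel)"
      using \<open>\<sigma> > 0\<close>
      by (subst nn_integral_nlborel_fst) (simp_all add: g_def nn_integral_multc[symmetric] ennreal_mult gauss_nonneg)
    also have "\<dots> = (\<integral>\<^sup>+x. ennreal ((cmod (F x))\<^sup>2) \<partial>nlborel)"
    proof (intro nn_integral_cong)
      fix x :: 'a
      show "(\<integral>\<^sup>+y. ennreal (gauss \<sigma> (y - x)) \<partial>nlborel) * ennreal ((cmod (F x))\<^sup>2) = ennreal ((cmod (F x))\<^sup>2)"
      using nn_integral_nlborel_plus[of "\<lambda>y. ennreal (gauss \<sigma> y)" "- x"] nn_integral_gauss[OF \<open>\<sigma> > 0\<close>, where 'a='a] by simp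
    qed
    finally show ?thesis using S by simp
  qed
  then have h1: "has_bochner_integral nlborel (\<lambda>p. g p * (cmod (F (fst p)))\<^sup>2) S"
    using \<open>S \<ge> 0\<close> by (intro has_bochner_integral_nn_integral) (auto simp: g)
  have "(\<integral>\<^sup>+p. ennreal (g p * (cmod (F (snd p)))\<^sup>2) \<partial>nlborel) = ennreal S"
  proof -
    have "(\<integral>\<^sup>+p. ennreal (g p * (cmod (F (snd p)))\<^sup>2) \<partial>nlborel)
      = (\<integral>\<^sup>+x. \<integral>\<^sup>+y. ennreal (gauss \<sigma> (y - x)) * ennreal ((cmod (F y))\<^sup>2) \<partial>nlborel \<partial>nlborel)"
      using \<open>\<sigma> > 0\<close>
      by (subst nn_integral_nlborel_fst) (simp_all add: g_def ennreal_mult gauss_nonneg)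
    also have "\<dots> = (\<integral>\<^sup>+y. (\<integral>\<^sup>+x. ennreal (gauss \<sigma> (y - x)) \<partial>nlborel) * ennreal ((cmod (F y))\<^sup>2) \<partial>nlborel)"
      by (subst nn_integral_nlborel_swap) (simp_all add: nn_integral_multc)
    also have "\<dots> = (\<integral>\<^sup>+x. ennreal ((cmod (F x))\<^sup>2) \<partial>nlborel)"
    proof (intro nn_integral_cong)
      fix y :: 'a
      show "(\<integral>\<^sup>+x. ennreal (gauss \<sigma> (y - x)) \<partial>nlborel) * ennreal ((cmod (F y))\<^sup>2) = ennreal ((cmod (F y))\<^sup>2)"
      using nn_integral_nlborel_minus[of "\<lambda>y. ennreal (gauss \<sigma> y)" y] nn_integral_gauss[OF \<open>\<sigma> > 0\<close>, where 'a='a] by simp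
    qed
    finally show ?thesis using S by simp
  qed
  then have h2: "has_bochner_integral nlborel (\<lambda>p. g p * (cmod (F (snd p)))\<^sup>2) S"
    using \<open>S \<ge> 0\<close> by (intro has_bochner_integral_nn_integral) (auto simp: g)
  define L where "L = (\<integral>w. (cmod (cfourier F w))\<^sup>2 * exp (- (\<sigma> * norm w)\<^sup>2 / 2) \<partial>nlborel)"
  have L: "(\<integral>\<^sup>+w. ennreal ((cmod (cfourier F w))\<^sup>2 * exp (- (\<sigma> * norm w)\<^sup>2 / 2)) \<partial>nlborel) = ennreal L"
    unfolding L_def by (rule nn_integral_eq_integral[OF plancherel_gauss(2)[OF F \<open>\<sigma> > 0\<close>]]) simp
  have "L \<ge> 0" by (simp add: L_def)
  have "integrable nlborel (\<lambda>p. of_real (g p) * (F (fst p) * cnj (F (snd p))))"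
  proof (rule Bochner_Integration.integrable_bound)
    show "integrable nlborel (\<lambda>p. g p * (cmod (F (fst p)))\<^sup>2 + g p * (cmod (F (snd p)))\<^sup>2)"
      using h1 h2 by (auto simp: has_bochner_integral_iff)
    have "g p * (cmod (F (fst p)) * cmod (F (snd p))) \<le> g p * ((cmod (F (fst p)))\<^sup>2 + (cmod (F (snd p)))\<^sup>2)" for p
      using sum_squares_bound[of "cmod (F (fst p))" "cmod (F (snd p))"]
        mult_nonneg_nonneg[OF norm_ge_zero norm_ge_zero, of "F (fst p)" "F (snd p)"]
      by (intro mult_left_mono g) linarith+
    then show "AE p in nlborel. norm (of_real (g p) * (F (fst p) * cnj (F (snd p))))
        \<le> norm (g p * (cmod (F (fst p)))\<^sup>2 + g p * (cmod (F (snd p)))\<^sup>2)"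
      using g by (intro AE_I2) (simp add: norm_mult distrib_left)
  qed simp
  then have "has_bochner_integral nlborel (\<lambda>p. of_real (g p) * (F (fst p) * cnj (F (snd p)))) (of_real L)"
    using plancherel_gauss(1)[OF F \<open>\<sigma> > 0\<close>] by (simp add: has_bochner_integral_iff g_def L_def)
  from has_bochner_integral_Re[OF this]
  have h3: "has_bochner_integral nlborel (\<lambda>p. Re (of_real (g p) * (F (fst p) * cnj (F (snd p))))) L"
    by simp
  have "has_bochner_integral nlborel (\<lambda>p. g p * (cmod (F (fst p)))\<^sup>2 + g p * (cmod (F (snd p)))\<^sup>2
      - 2 * Re (of_real (g p) * (F (fst p) * cnj (F (snd p))))) (S + S - 2 * L)"
    by (intro has_bochner_integral_diff has_bochner_integral_add h1 h2 has_bochner_integral_mult_right h3)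
  moreover have "g p * (cmod (F (fst p)))\<^sup>2 + g p * (cmod (F (snd p)))\<^sup>2
      - 2 * Re (of_real (g p) * (F (fst p) * cnj (F (snd p)))) = g p * (cmod (F (fst p) - F (snd p)))\<^sup>2" for p
    unfolding cmod_power2 by (simp add: power2_eq_square algebra_simps)
  ultimately have h4: "has_bochner_integral nlborel (\<lambda>p. g p * (cmod (F (fst p) - F (snd p)))\<^sup>2) (S + S - 2 * L)"
    by simp
  then have nn: "(\<integral>\<^sup>+p. ennreal (g p * (cmod (F (fst p) - F (snd p)))\<^sup>2) \<partial>nlborel) = ennreal (S + S - 2 * L)"
    by (subst nn_integral_eq_integral) (auto simp: has_bochner_integral_iff g)
  \<comment> \<open>Needed before \<open>nn\<close> can be combined with the other terms, since
    \<open>ennreal\<close> sends negative numbers to 0.\<close>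
  have "S + S - 2 * L \<ge> 0"
  proof -
    have "S + S - 2 * L = (\<integral>p. g p * (cmod (F (fst p) - F (snd p)))\<^sup>2 \<partial>nlborel)"
      using h4 by (simp add: has_bochner_integral_iff)
    also have "\<dots> \<ge> 0"
      by (intro Bochner_Integration.integral_nonneg) (simp add: g)
    finally show ?thesis .
  qed
  then show ?thesis
    using \<open>L \<ge> 0\<close> \<open>S \<ge> 0\<close> nn unfolding L S g_def
    by (simp add: ennreal_mult[symmetric] flip: ennreal_plus ennreal_numeral)
qed

text \<open>In the regularized identity the weights increase to 1, so the first term converges
  monotonically, while the error term tends to 0.\<close>

theorem plancherel:
  fixes F :: "'a::euclidean_space \<Rightarrow> complex"
  assumes F: "integrable nlborel F" and fin: "integrable nlborel (\<lambda>x. (cmod (F x))\<^sup>2)"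
  shows "(\<integral>\<^sup>+w. ennreal ((cmod (cfourier F w))\<^sup>2) \<partial>nlborel) = (\<integral>\<^sup>+x. ennreal ((cmod (F x))\<^sup>2) \<partial>nlborel)"
proof -
  have [measurable]: "F \<in> borel_measurable borel"
    using F by (auto dest: borel_measurable_integrable)
  define \<sigma> where "\<sigma> n = 1 / real (Suc n)" for n
  have \<sigma>: "\<sigma> \<longlonglongrightarrow> 0" "\<And>n. \<sigma> n > 0"
    using LIMSEQ_inverse_real_of_nat by (auto simp: \<sigma>_def[abs_def] inverse_eq_divide)
  let ?L = "\<lambda>n. \<integral>\<^sup>+w. ennreal ((cmod (cfourier F w))\<^sup>2 * exp (- (\<sigma> n * norm w)\<^sup>2 / 2)) \<partial>nlborel"
  let ?E = "\<lambda>n. \<integral>\<^sup>+p. ennreal (gauss (\<sigma> n) (snd p - fst p) * (cmod (F (fst p) - F (snd p)))\<^sup>2) \<partial>nlborel"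
  have "?L \<longlonglongrightarrow> (\<integral>\<^sup>+w. ennreal ((cmod (cfourier F w))\<^sup>2) \<partial>nlborel)"
  proof (rule nn_integral_LIMSEQ)
    show "incseq (\<lambda>n w. ennreal ((cmod (cfourier F w))\<^sup>2 * exp (- (\<sigma> n * norm w)\<^sup>2 / 2)))"
    proof (intro incseq_SucI le_funI ennreal_leI mult_left_mono)
      fix n and w :: 'a
      have "(\<sigma> (Suc n) * norm w)\<^sup>2 \<le> (\<sigma> n * norm w)\<^sup>2"
        by (intro power_mono mult_right_mono) (auto simp: \<sigma>_def frac_le)
      then show "exp (- (\<sigma> n * norm w)\<^sup>2 / 2) \<le> exp (- (\<sigma> (Suc n) * norm w)\<^sup>2 / 2)"
        by simp
    qed simp
    show "(\<lambda>n. ennreal ((cmod (cfourier F w))\<^sup>2 * exp (- (\<sigma> n * norm w)\<^sup>2 / 2))) \<longlonglongrightarrow> ennreal ((cmod (cfourier F w))\<^sup>2)" for w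
      using \<sigma>(1) by (intro tendsto_ennrealI) (auto intro!: tendsto_eq_intros)
  qed simp
  moreover have "?E \<longlonglongrightarrow> 0"
    by (rule gauss_translation_tendsto[OF _ fin \<sigma>]) simp
  ultimately have "(\<lambda>n. 2 * ?L n + ?E n) \<longlonglongrightarrow> 2 * (\<integral>\<^sup>+w. ennreal ((cmod (cfourier F w))\<^sup>2) \<partial>nlborel) + 0"
    by (intro tendsto_add ennreal_tendsto_cmult) auto
  then have "(\<lambda>n. 2 * (\<integral>\<^sup>+x. ennreal ((cmod (F x))\<^sup>2) \<partial>nlborel)) \<longlonglongrightarrow> 2 * (\<integral>\<^sup>+w. ennreal ((cmod (cfourier F w))\<^sup>2) \<partial>nlborel)"
    unfolding plancherel_gauss_identity[OF F fin \<sigma>(2)] by simp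
  then have "2 * (\<integral>\<^sup>+x. ennreal ((cmod (F x))\<^sup>2) \<partial>nlborel) = 2 * (\<integral>\<^sup>+w. ennreal ((cmod (cfourier F w))\<^sup>2) \<partial>nlborel)"
    by (simp add: LIMSEQ_const_iff)
  then show ?thesis
    by (subst (asm) ennreal_mult_cancel_left) auto
qed

text \<open>If \<open>F\<close> is not square integrable, the right side is infinite. This form
  serves convolutions of integrable functions, which need not be square integrable.\<close>

lemma plancherel_le:
  fixes F :: "'a::euclidean_space \<Rightarrow> complex"
  assumes F: "integrable nlborel F"
  shows "(\<integral>\<^sup>+w. ennreal ((cmod (cfourier F w))\<^sup>2) \<partial>nlborel) \<le> (\<integral>\<^sup>+x. ennreal ((cmod (F x))\<^sup>2) \<partial>nlborel)"
proof (cases "integrable nlborel (\<lambda>x. (cmod (F x))\<^sup>2)")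
  case True
  then show ?thesis by (simp add: plancherel[OF F])
next
  case False
  have "F \<in> borel_measurable borel"
    using F by (auto dest: borel_measurable_integrable)
  with False have "(\<integral>\<^sup>+x. ennreal ((cmod (F x))\<^sup>2) \<partial>nlborel) = \<infinity>"
    by (auto simp: integrable_iff_bounded less_top[symmetric])
  then show ?thesis by simp
qed

section \<open>Convolutions and one-sided quaternion Fourier transforms\<close>

lemma integrable_convolution:
  fixes F G :: "'a::euclidean_space \<Rightarrow> complex"
  assumes F: "integrable nlborel F" and G: "integrable nlborel G"
  shows "integrable nlborel (\<lambda>p. F (snd p) * G (fst p - snd p))"
proof -
  have [measurable]: "F \<in> borel_measurable borel" "G \<in> borel_measurable borel"
    using F G by (auto dest: borel_measurable_integrable)
  have "(\<integral>\<^sup>+p. ennreal (norm (F (snd p) * G (fst p - snd p))) \<partial>nlborel)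
      = (\<integral>\<^sup>+u. \<integral>\<^sup>+s. ennreal (norm (F s)) * ennreal (norm (G (u - s))) \<partial>nlborel \<partial>nlborel)"
    by (subst nn_integral_nlborel_fst) (simp_all add: norm_mult ennreal_mult)
  also have "\<dots> = (\<integral>\<^sup>+s. \<integral>\<^sup>+u. ennreal (norm (F s)) * ennreal (norm (G (u - s))) \<partial>nlborel \<partial>nlborel)"
    by (rule nn_integral_nlborel_swap) simp
  also have "\<dots> = (\<integral>\<^sup>+s. ennreal (norm (F s)) * (\<integral>\<^sup>+u. ennreal (norm (G u)) \<partial>nlborel) \<partial>nlborel)"
  proof (rule nn_integral_cong)
    fix s :: 'a
    show "(\<integral>\<^sup>+u. ennreal (norm (F s)) * ennreal (norm (G (u - s))) \<partial>nlborel)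
      = ennreal (norm (F s)) * (\<integral>\<^sup>+u. ennreal (norm (G u)) \<partial>nlborel)"
      using nn_integral_nlborel_plus[of "\<lambda>u. ennreal (norm (G u))" "- s"]
      by (simp add: nn_integral_cmult)
  qed
  also have "\<dots> = (\<integral>\<^sup>+s. ennreal (norm (F s)) \<partial>nlborel) * (\<integral>\<^sup>+u. ennreal (norm (G u)) \<partial>nlborel)"
    by (simp add: nn_integral_multc)
  also have "\<dots> < \<infinity>"
    using F G by (auto simp: integrable_iff_bounded ennreal_mult_less_top)
  finally show ?thesis
    by (intro integrableI_bounded) simp_all
qed

definition convol :: "('a::euclidean_space \<Rightarrow> complex) \<Rightarrow> ('a \<Rightarrow> complex) \<Rightarrow> 'a \<Rightarrow> complex" where
  "convol F G u = (\<integral>s. F s * G (u - s) \<partial>nlborel)"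

lemma convol_integral:
  fixes F G :: "'a::euclidean_space \<Rightarrow> complex"
  assumes F: "integrable nlborel F" and G: "integrable nlborel G"
  shows "integrable nlborel (convol F G)"
    and "(\<integral>u. convol F G u \<partial>nlborel) = (\<integral>s. F s \<partial>nlborel) * (\<integral>s. G s \<partial>nlborel)"
proof -
  have [measurable]: "G \<in> borel_measurable borel"
    using G by (auto dest: borel_measurable_integrable)
  note * = nlborel_Fubini[OF integrable_convolution[OF F G], simplified]
  show "integrable nlborel (convol F G)"
    using *(3) by (simp add: convol_def[abs_def])
  have "(\<integral>u. convol F G u \<partial>nlborel) = (\<integral>s. \<integral>u. F s * G (u - s) \<partial>nlborel \<partial>nlborel)"
    unfolding convol_def using *(1,2) by simp
  also have "(\<lambda>s. \<integral>u. F s * G (u - s) \<partial>nlborel) = (\<lambda>s. F s * (\<integral>u. G u \<partial>nlborel))"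
    using integral_nlborel_plus[of G "- _"] by simp
  finally show "(\<integral>u. convol F G u \<partial>nlborel) = (\<integral>s. F s \<partial>nlborel) * (\<integral>s. G s \<partial>nlborel)"
    by simp
qed

text \<open>The character splits along \<open>u = s + (u - s)\<close> and is absorbed into the two
  factors; what remains is the integral of a convolution.\<close>

lemma cfourier_convol:
  fixes F G :: "'a::euclidean_space \<Rightarrow> complex"
  assumes F: "integrable nlborel F" and G: "integrable nlborel G"
  shows "cfourier (convol F G) w = cfourier F w * cfourier G w"
proof -
  have "cis (- (w \<bullet> u)) * convol F G u
      = convol (\<lambda>s. cis (- (w \<bullet> s)) * F s) (\<lambda>s. cis (- (w \<bullet> s)) * G s) u" for u
  proof -
    have "cis (- (w \<bullet> u)) = cis (- (w \<bullet> s)) * cis (- (w \<bullet> (u - s)))" for s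
      by (simp add: cis_mult inner_diff_right)
    then have *: "cis (- (w \<bullet> u)) * (F s * G (u - s))
        = cis (- (w \<bullet> s)) * F s * (cis (- (w \<bullet> (u - s))) * G (u - s))" for s
      by (metis (no_types, lifting) mult.assoc mult.left_commute)
    show ?thesis
      unfolding convol_def
      by (subst integral_mult_right_zero[symmetric]) (rule Bochner_Integration.integral_cong[OF refl *])
  qed
  then show ?thesis
    unfolding cfourier_def by (simp add: convol_integral integrable_cis_times F G)
qed

section \<open>Quaternions as pairs of complex numbers\<close>

definition quat_c1 :: "quat \<Rightarrow> complex" where "quat_c1 x = Complex (qRe x) (qI x)"
definition quat_c2 :: "quat \<Rightarrow> complex" where "quat_c2 x = Complex (qJ x) (qK x)"
text \<open>Exchanging the units \<open>i\<close> and \<open>j\<close> (without the sign of \<open>k\<close>) turns right multiplication by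
  \<open>exp (- j \<theta>)\<close> into left multiplication by \<open>exp (- i \<theta>)\<close>.\<close>

definition quat_swap :: "quat \<Rightarrow> quat" where "quat_swap x = Quat (qRe x) (qJ x) (qI x) (qK x)"

lemma norm_quat_sq: "(norm x)\<^sup>2 = (qRe x)\<^sup>2 + (qI x)\<^sup>2 + (qJ x)\<^sup>2 + (qK x)\<^sup>2"
  by (simp add: norm_quat_def)

lemma norm_quat_c: "(norm x)\<^sup>2 = (cmod (quat_c1 x))\<^sup>2 + (cmod (quat_c2 x))\<^sup>2"
  by (simp add: norm_quat_sq quat_c1_def quat_c2_def cmod_power2)

lemma norm_quat_swap [simp]: "norm (quat_swap x) = norm x"
  by (simp add: norm_quat_def quat_swap_def add_ac)

lemma quat_swap_swap [simp]: "quat_swap (quat_swap x) = x"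
  by (simp add: quat_swap_def)

lemma bounded_linear_quat_c1: "bounded_linear quat_c1"
  unfolding linear_conv_bounded_linear[symmetric]
  by (rule linearI) (simp_all add: quat_c1_def complex_eq_iff)

lemma bounded_linear_quat_c2: "bounded_linear quat_c2"
  unfolding linear_conv_bounded_linear[symmetric]
  by (rule linearI) (simp_all add: quat_c2_def complex_eq_iff)

lemma bounded_linear_quat_swap: "bounded_linear quat_swap"
  unfolding linear_conv_bounded_linear[symmetric]
  by (rule linearI) (simp_all add: quat_swap_def quat_eq_iff)

lemma quat_c_measurable [measurable]:
  "quat_c1 \<in> borel_measurable borel" "quat_c2 \<in> borel_measurable borel" "quat_swap \<in> borel_measurable borel"
  by (auto intro!: borel_measurable_continuous_onI linear_continuous_on
      bounded_linear_quat_c1 bounded_linear_quat_c2 bounded_linear_quat_swap)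

text \<open>A bounded algebra homomorphism passes through the exponential series. It carries Euler's
  formula to the planes spanned by \<open>1, quat_i\<close> and by \<open>1, quat_j\<close>.\<close>

lemma exp_embed_complex:
  fixes \<phi> :: "complex \<Rightarrow> 'b::{real_normed_algebra_1, banach}"
  assumes "bounded_linear \<phi>" and mult: "\<And>x y. \<phi> (x * y) = \<phi> x * \<phi> y" and one: "\<phi> 1 = 1"
  shows "exp (\<phi> z) = \<phi> (exp z)"
proof -
  interpret bounded_linear \<phi> by fact
  have "\<phi> z ^ n = \<phi> (z ^ n)" for n
    by (induction n) (simp_all add: one mult)
  moreover have "(\<lambda>n. \<phi> (z ^ n /\<^sub>R fact n)) sums \<phi> (exp z)"
    by (intro sums exp_converges)
  ultimately have "(\<lambda>n. \<phi> z ^ n /\<^sub>R fact n) sums \<phi> (exp z)"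
    by (simp add: scale)
  then show ?thesis
    using exp_converges[of "\<phi> z"] sums_unique2 by blast
qed

lemma exp_quat_i: "exp (\<theta> *\<^sub>R quat_i) = Quat (cos \<theta>) (sin \<theta>) 0 0"
proof -
  define \<phi> where "\<phi> z = Quat (Re z) (Im z) 0 0" for z
  have "bounded_linear \<phi>"
    unfolding linear_conv_bounded_linear[symmetric]
    by (rule linearI) (simp_all add: \<phi>_def quat_eq_iff)
  then have "exp (\<phi> (\<i> * of_real \<theta>)) = \<phi> (exp (\<i> * of_real \<theta>))"
    by (rule exp_embed_complex) (simp_all add: \<phi>_def quat_eq_iff)
  moreover have "\<phi> (\<i> * of_real \<theta>) = \<theta> *\<^sub>R quat_i"
    by (simp add: \<phi>_def quat_eq_iff quat_i_def)
  ultimately show ?thesis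
    by (simp add: \<phi>_def cis_conv_exp[symmetric])
qed

lemma exp_quat_j: "exp (\<theta> *\<^sub>R quat_j) = Quat (cos \<theta>) 0 (sin \<theta>) 0"
proof -
  define \<phi> where "\<phi> z = Quat (Re z) 0 (Im z) 0" for z
  have "bounded_linear \<phi>"
    unfolding linear_conv_bounded_linear[symmetric]
    by (rule linearI) (simp_all add: \<phi>_def quat_eq_iff)
  then have "exp (\<phi> (\<i> * of_real \<theta>)) = \<phi> (exp (\<i> * of_real \<theta>))"
    by (rule exp_embed_complex) (simp_all add: \<phi>_def quat_eq_iff)
  moreover have "\<phi> (\<i> * of_real \<theta>) = \<theta> *\<^sub>R quat_j"
    by (simp add: \<phi>_def quat_eq_iff quat_j_def)
  ultimately show ?thesis
    by (simp add: \<phi>_def cis_conv_exp[symmetric])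
qed

lemma norm_exp_quat [simp]:
  "norm (exp (\<theta> *\<^sub>R quat_i)) = 1" "norm (exp (\<theta> *\<^sub>R quat_j)) = 1"
  "norm (exp (- (\<theta> *\<^sub>R quat_i))) = 1" "norm (exp (- (\<theta> *\<^sub>R quat_j))) = 1"
  using exp_quat_i[of "- \<theta>"] exp_quat_j[of "- \<theta>"]
  by (simp_all add: exp_quat_i exp_quat_j norm_quat_def)

text \<open>With complex numbers embedded through \<open>quat_i\<close>, \<open>x\<close> is
  \<open>quat_c1 x + quat_c2 x * quat_j\<close>, so left multiplication by a complex number scales
  both parts. This is what makes the left transform a pair of independent complex
  transforms.\<close>

lemma quat_c1_exp: "quat_c1 (exp (- (\<theta> *\<^sub>R quat_i)) * x) = cis (- \<theta>) * quat_c1 x"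
  and quat_c2_exp: "quat_c2 (exp (- (\<theta> *\<^sub>R quat_i)) * x) = cis (- \<theta>) * quat_c2 x"
  using exp_quat_i[of "- \<theta>"] by (simp_all add: quat_c1_def quat_c2_def complex_eq_iff)

text \<open>An instance of \<open>quat_swap\<close> being an anti-automorphism: exchanging
  \<open>i\<close> and \<open>j\<close> and fixing \<open>k\<close> reverses products, as
  \<open>i * j = k\<close> is mapped to itself.\<close>

lemma quat_swap_exp: "quat_swap (x * exp (- (\<theta> *\<^sub>R quat_j))) = exp (- (\<theta> *\<^sub>R quat_i)) * quat_swap x"
  using exp_quat_i[of "- \<theta>"] exp_quat_j[of "- \<theta>"] by (simp add: quat_swap_def quat_eq_iff)

definition lfourier :: "('a::euclidean_space \<Rightarrow> quat) \<Rightarrow> 'a \<Rightarrow> quat" where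
  "lfourier h w = (\<integral>t. exp (- ((w \<bullet> t) *\<^sub>R quat_i)) * h t \<partial>nlborel)"

definition rfourier :: "('a::euclidean_space \<Rightarrow> quat) \<Rightarrow> 'a \<Rightarrow> quat" where
  "rfourier h w = (\<integral>t. h t * exp (- ((w \<bullet> t) *\<^sub>R quat_j)) \<partial>nlborel)"

lemma exp_quat_measurable [measurable (raw)]:
  assumes [measurable]: "f \<in> borel_measurable M"
  shows "(\<lambda>x. exp (- (f x *\<^sub>R quat_i))) \<in> borel_measurable M"
    and "(\<lambda>x. exp (- (f x *\<^sub>R quat_j))) \<in> borel_measurable M"
proof -
  have "exp (- (\<theta> *\<^sub>R quat_i)) = cos \<theta> *\<^sub>R 1 - sin \<theta> *\<^sub>R quat_i" for \<theta>
    using exp_quat_i[of "- \<theta>"] by (simp add: quat_eq_iff quat_i_def)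
  then show "(\<lambda>x. exp (- (f x *\<^sub>R quat_i))) \<in> borel_measurable M" by simp
  have "exp (- (\<theta> *\<^sub>R quat_j)) = cos \<theta> *\<^sub>R 1 - sin \<theta> *\<^sub>R quat_j" for \<theta>
    using exp_quat_j[of "- \<theta>"] by (simp add: quat_eq_iff quat_j_def)
  then show "(\<lambda>x. exp (- (f x *\<^sub>R quat_j))) \<in> borel_measurable M" by simp
qed

lemma integrable_exp_quat_i_iff:
  assumes [measurable]: "h \<in> borel_measurable borel"
  shows "integrable nlborel (\<lambda>t. exp (- ((w \<bullet> t) *\<^sub>R quat_i)) * h t) \<longleftrightarrow> integrable nlborel h"
  by (simp add: integrable_iff_bounded norm_mult)

lemma lfourier_c:
  fixes h :: "'a::euclidean_space \<Rightarrow> quat"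
  assumes h: "integrable nlborel h"
  shows "quat_c1 (lfourier h w) = cfourier (\<lambda>t. quat_c1 (h t)) w"
    and "quat_c2 (lfourier h w) = cfourier (\<lambda>t. quat_c2 (h t)) w"
proof -
  have [measurable]: "h \<in> borel_measurable borel"
    using h by (auto dest: borel_measurable_integrable)
  have *: "integrable nlborel (\<lambda>t. exp (- ((w \<bullet> t) *\<^sub>R quat_i)) * h t)"
    using h by (simp add: integrable_exp_quat_i_iff)
  show "quat_c1 (lfourier h w) = cfourier (\<lambda>t. quat_c1 (h t)) w"
    unfolding lfourier_def cfourier_def
    by (subst integral_bounded_linear[OF bounded_linear_quat_c1 *, symmetric]) (simp add: quat_c1_exp)
  show "quat_c2 (lfourier h w) = cfourier (\<lambda>t. quat_c2 (h t)) w"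
    unfolding lfourier_def cfourier_def
    by (subst integral_bounded_linear[OF bounded_linear_quat_c2 *, symmetric]) (simp add: quat_c2_exp)
qed

lemma lfourier_not_integrable:
  assumes "h \<in> borel_measurable borel" "\<not> integrable nlborel h"
  shows "lfourier h w = 0"
  unfolding lfourier_def using assms by (intro not_integrable_integral_eq) (simp add: integrable_exp_quat_i_iff)

lemma rfourier_swap: "quat_swap (rfourier h w) = lfourier (\<lambda>t. quat_swap (h t)) w"
  unfolding rfourier_def lfourier_def
  \<comment> \<open>The primed rule asks for an inverse map in place of integrability;
    \<open>quat_swap\<close> is its own inverse.\<close>
  by (subst integral_bounded_linear'[OF bounded_linear_quat_swap bounded_linear_quat_swap, symmetric])
     (simp_all add: quat_swap_exp)

lemma norm_rfourier: "norm (rfourier h w) = norm (lfourier (\<lambda>t. quat_swap (h t)) w)"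
  by (simp add: rfourier_swap[symmetric])

lemma integrable_quat_c:
  fixes h :: "'a \<Rightarrow> quat"
  assumes "integrable M h"
  shows "integrable M (\<lambda>t. quat_c1 (h t))" "integrable M (\<lambda>t. quat_c2 (h t))"
  by (auto intro: integrable_bounded_linear[OF bounded_linear_quat_c1 assms] integrable_bounded_linear[OF bounded_linear_quat_c2 assms])

lemma lfourier_plancherel:
  fixes h :: "'a::euclidean_space \<Rightarrow> quat"
  assumes h: "integrable nlborel h" and fin: "integrable nlborel (\<lambda>x. (norm (h x))\<^sup>2)"
  shows "(\<integral>\<^sup>+w. ennreal ((norm (lfourier h w))\<^sup>2) \<partial>nlborel) = (\<integral>\<^sup>+x. ennreal ((norm (h x))\<^sup>2) \<partial>nlborel)"
proof -
  have [measurable]: "h \<in> borel_measurable borel"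
    using h by (auto dest: borel_measurable_integrable)
  have 1: "integrable nlborel (\<lambda>x. (cmod (quat_c1 (h x)))\<^sup>2)"
    using fin by (rule Bochner_Integration.integrable_bound) (auto simp: norm_quat_c)
  have 2: "integrable nlborel (\<lambda>x. (cmod (quat_c2 (h x)))\<^sup>2)"
    using fin by (rule Bochner_Integration.integrable_bound) (auto simp: norm_quat_c)
  show ?thesis
    unfolding norm_quat_c lfourier_c[OF h]
    by (simp add: nn_integral_add plancherel integrable_quat_c h 1 2)
qed

lemma rfourier_plancherel:
  fixes h :: "'a::euclidean_space \<Rightarrow> quat"
  assumes h: "integrable nlborel h" and fin: "integrable nlborel (\<lambda>x. (norm (h x))\<^sup>2)"
  shows "(\<integral>\<^sup>+w. ennreal ((norm (rfourier h w))\<^sup>2) \<partial>nlborel) = (\<integral>\<^sup>+x. ennreal ((norm (h x))\<^sup>2) \<partial>nlborel)"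
  using lfourier_plancherel[OF integrable_bounded_linear[OF bounded_linear_quat_swap h]] fin
  by (simp add: norm_rfourier)

text \<open>The four convolutions are the components of the tensor product over \<open>\<complex>\<close> of \<open>h1\<close> and \<open>h2\<close>, whose
  norm is the product of the norms.\<close>

lemma convol_tensor_le:
  fixes h1 h2 :: "'a::euclidean_space \<Rightarrow> quat"
  assumes [measurable]: "h1 \<in> borel_measurable borel" "h2 \<in> borel_measurable borel"
  defines "A \<equiv> \<lambda>t. quat_c1 (h1 t)" and "B \<equiv> \<lambda>t. quat_c2 (h1 t)"
    and "C \<equiv> \<lambda>t. quat_c1 (h2 t)" and "D \<equiv> \<lambda>t. quat_c2 (h2 t)"
  shows "ennreal ((cmod (convol A C u))\<^sup>2 + (cmod (convol A D u))\<^sup>2 + (cmod (convol B C u))\<^sup>2 + (cmod (convol B D u))\<^sup>2)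
    \<le> (\<integral>\<^sup>+s. ennreal (norm (h1 s)) * ennreal (norm (h2 (u - s))) \<partial>nlborel)\<^sup>2"
proof -
  \<comment> \<open>The four convolutions form one vector-valued integral, bounded by the integral
    of the norm. Bounding each component by the product of norms would lose a factor 4.\<close>
  define T where "T s = ((A s * C (u - s), A s * D (u - s)), (B s * C (u - s), B s * D (u - s)))" for s
  have [measurable]: "T \<in> borel_measurable borel"
    unfolding T_def A_def B_def C_def D_def by measurable
  have norm4: "(norm ((a, b), (c, d)))\<^sup>2 = (cmod a)\<^sup>2 + (cmod b)\<^sup>2 + (cmod c)\<^sup>2 + (cmod d)\<^sup>2" for a b c d
    by (simp add: norm_Pair)
  have "(norm (T s))\<^sup>2 = (norm (h1 s) * norm (h2 (u - s)))\<^sup>2" for s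
    unfolding T_def norm4 power_mult_distrib norm_quat_c
    by (simp add: A_def B_def C_def D_def norm_mult power_mult_distrib algebra_simps)
  then have normT: "norm (T s) = norm (h1 s) * norm (h2 (u - s))" for s
    by (rule power2_eq_imp_eq) auto
  then have eq: "(\<integral>\<^sup>+s. ennreal (norm (h1 s)) * ennreal (norm (h2 (u - s))) \<partial>nlborel) = (\<integral>\<^sup>+s. ennreal (norm (T s)) \<partial>nlborel)"
    by (simp add: ennreal_mult)
  show ?thesis
  proof (cases "integrable nlborel T")
    case True
    have i1: "fst (fst (\<integral>s. T s \<partial>nlborel)) = convol A C u" "snd (fst (\<integral>s. T s \<partial>nlborel)) = convol A D u"
      "fst (snd (\<integral>s. T s \<partial>nlborel)) = convol B C u" "snd (snd (\<integral>s. T s \<partial>nlborel)) = convol B D u"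
    proof -
      note fst_T = Bochner_Integration.integral_fst[OF True] Bochner_Integration.integrable_fst[OF True]
      note snd_T = Bochner_Integration.integral_snd[OF True] Bochner_Integration.integrable_snd[OF True]
      show "fst (fst (\<integral>s. T s \<partial>nlborel)) = convol A C u"
        unfolding fst_T(1)[symmetric] Bochner_Integration.integral_fst[OF fst_T(2), symmetric]
        by (simp add: convol_def T_def)
      show "snd (fst (\<integral>s. T s \<partial>nlborel)) = convol A D u"
        unfolding fst_T(1)[symmetric] Bochner_Integration.integral_snd[OF fst_T(2), symmetric]
        by (simp add: convol_def T_def)
      show "fst (snd (\<integral>s. T s \<partial>nlborel)) = convol B C u"
        unfolding snd_T(1)[symmetric] Bochner_Integration.integral_fst[OF snd_T(2), symmetric]
        by (simp add: convol_def T_def)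
      show "snd (snd (\<integral>s. T s \<partial>nlborel)) = convol B D u"
        unfolding snd_T(1)[symmetric] Bochner_Integration.integral_snd[OF snd_T(2), symmetric]
        by (simp add: convol_def T_def)
    qed
    then have "(\<integral>s. T s \<partial>nlborel) = ((convol A C u, convol A D u), (convol B C u, convol B D u))"
      by (simp add: prod_eq_iff)
    then have "ennreal ((cmod (convol A C u))\<^sup>2 + (cmod (convol A D u))\<^sup>2 + (cmod (convol B C u))\<^sup>2 + (cmod (convol B D u))\<^sup>2)
        = (ennreal (norm (\<integral>s. T s \<partial>nlborel)))\<^sup>2"
      by (simp add: ennreal_power norm4)
    also have "\<dots> \<le> (\<integral>\<^sup>+s. ennreal (norm (T s)) \<partial>nlborel)\<^sup>2"
      by (intro power_mono_ennreal integral_norm_bound_ennreal True)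
    finally show ?thesis by (simp add: eq)
  next
    case False
    then have "(\<integral>\<^sup>+s. ennreal (norm (T s)) \<partial>nlborel) = \<infinity>"
      by (auto simp: integrable_iff_bounded less_top[symmetric])
    then show ?thesis by (simp add: eq power2_eq_square)
  qed
qed

text \<open>No integrability is assumed: the transform of a non-integrable function is \<open>0\<close> by convention.\<close>

lemma lfourier_mult_bound:
  fixes h1 h2 :: "'a::euclidean_space \<Rightarrow> quat"
  assumes [measurable]: "h1 \<in> borel_measurable borel" "h2 \<in> borel_measurable borel"
  shows "(\<integral>\<^sup>+w. ennreal ((norm (lfourier h1 w))\<^sup>2 * (norm (lfourier h2 w))\<^sup>2) \<partial>nlborel)
    \<le> (\<integral>\<^sup>+u. (\<integral>\<^sup>+s. ennreal (norm (h1 s)) * ennreal (norm (h2 (u - s))) \<partial>nlborel)\<^sup>2 \<partial>nlborel)"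
proof (cases "integrable nlborel h1 \<and> integrable nlborel h2")
  case True
  then have h: "integrable nlborel h1" "integrable nlborel h2" by auto
  define A where "A = (\<lambda>t. quat_c1 (h1 t))"
  define B where "B = (\<lambda>t. quat_c2 (h1 t))"
  define C where "C = (\<lambda>t. quat_c1 (h2 t))"
  define D where "D = (\<lambda>t. quat_c2 (h2 t))"
  note defs = A_def B_def C_def D_def
  have i: "integrable nlborel A" "integrable nlborel B" "integrable nlborel C" "integrable nlborel D"
    unfolding defs by (simp_all add: integrable_quat_c h)
  note ci = convol_integral(1)[OF i(1) i(3)] convol_integral(1)[OF i(1) i(4)]
     convol_integral(1)[OF i(2) i(3)] convol_integral(1)[OF i(2) i(4)]
  have [measurable]: "convol A C \<in> borel_measurable borel" "convol A D \<in> borel_measurable borel"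
     "convol B C \<in> borel_measurable borel" "convol B D \<in> borel_measurable borel"
    using ci[THEN borel_measurable_integrable] by simp_all
  \<comment> \<open>Each squared norm is a sum of two squared moduli. Expanding the product gives
    four squared moduli of products of complex transforms, to which the convolution theorem
    applies.\<close>
  have "(norm (lfourier h1 w))\<^sup>2 * (norm (lfourier h2 w))\<^sup>2
      = (cmod (cfourier (convol A C) w))\<^sup>2 + (cmod (cfourier (convol A D) w))\<^sup>2
        + (cmod (cfourier (convol B C) w))\<^sup>2 + (cmod (cfourier (convol B D) w))\<^sup>2" for w
    unfolding norm_quat_c lfourier_c[OF h(1)] lfourier_c[OF h(2)] A_def[symmetric] B_def[symmetric] C_def[symmetric] D_def[symmetric]
    by (simp add: cfourier_convol i norm_mult power_mult_distrib algebra_simps)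
  then have "(\<integral>\<^sup>+w. ennreal ((norm (lfourier h1 w))\<^sup>2 * (norm (lfourier h2 w))\<^sup>2) \<partial>nlborel)
      = (\<integral>\<^sup>+w. ennreal ((cmod (cfourier (convol A C) w))\<^sup>2) \<partial>nlborel)
      + (\<integral>\<^sup>+w. ennreal ((cmod (cfourier (convol A D) w))\<^sup>2) \<partial>nlborel)
      + (\<integral>\<^sup>+w. ennreal ((cmod (cfourier (convol B C) w))\<^sup>2) \<partial>nlborel)
      + (\<integral>\<^sup>+w. ennreal ((cmod (cfourier (convol B D) w))\<^sup>2) \<partial>nlborel)"
    by (simp add: nn_integral_add)
  also have "\<dots> \<le> (\<integral>\<^sup>+u. ennreal ((cmod (convol A C u))\<^sup>2) \<partial>nlborel)
      + (\<integral>\<^sup>+u. ennreal ((cmod (convol A D u))\<^sup>2) \<partial>nlborel)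
      + (\<integral>\<^sup>+u. ennreal ((cmod (convol B C u))\<^sup>2) \<partial>nlborel)
      + (\<integral>\<^sup>+u. ennreal ((cmod (convol B D u))\<^sup>2) \<partial>nlborel)"
    by (intro add_mono plancherel_le ci)
  also have "\<dots> = (\<integral>\<^sup>+u. ennreal ((cmod (convol A C u))\<^sup>2 + (cmod (convol A D u))\<^sup>2 + (cmod (convol B C u))\<^sup>2 + (cmod (convol B D u))\<^sup>2) \<partial>nlborel)"
    by (simp add: nn_integral_add)
  also have "\<dots> \<le> (\<integral>\<^sup>+u. (\<integral>\<^sup>+s. ennreal (norm (h1 s)) * ennreal (norm (h2 (u - s))) \<partial>nlborel)\<^sup>2 \<partial>nlborel)"
    unfolding defs by (intro nn_integral_mono convol_tensor_le) auto
  finally show ?thesis .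
next
  case False
  then have "lfourier h1 w = 0 \<or> lfourier h2 w = 0" for w
    by (auto simp: lfourier_not_integrable)
  then have "(norm (lfourier h1 w))\<^sup>2 * (norm (lfourier h2 w))\<^sup>2 = 0" for w
    by auto
  then show ?thesis by (simp only:) simp
qed

lemma rfourier_mult_bound:
  fixes h1 h2 :: "'a::euclidean_space \<Rightarrow> quat"
  assumes [measurable]: "h1 \<in> borel_measurable borel" "h2 \<in> borel_measurable borel"
  shows "(\<integral>\<^sup>+w. ennreal ((norm (rfourier h1 w))\<^sup>2 * (norm (rfourier h2 w))\<^sup>2) \<partial>nlborel)
    \<le> (\<integral>\<^sup>+u. (\<integral>\<^sup>+s. ennreal (norm (h1 s)) * ennreal (norm (h2 (u - s))) \<partial>nlborel)\<^sup>2 \<partial>nlborel)"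
  using lfourier_mult_bound[of "\<lambda>t. quat_swap (h1 t)" "\<lambda>t. quat_swap (h2 t)"] by (simp add: norm_rfourier)

section \<open>Fourth moments\<close>

lemma nn_integral_nlborel_half:
  fixes f :: "'a::euclidean_space \<Rightarrow> ennreal"
  assumes [measurable]: "f \<in> borel_measurable borel"
  shows "(\<integral>\<^sup>+x. f (t + x /\<^sub>R 2) \<partial>nlborel) = 2 ^ DIM('a) * (\<integral>\<^sup>+x. f x \<partial>nlborel)"
    and "(\<integral>\<^sup>+x. f (t - x /\<^sub>R 2) \<partial>nlborel) = 2 ^ DIM('a) * (\<integral>\<^sup>+x. f x \<partial>nlborel)"
proof -
  have *: "2 ^ DIM('a) * ennreal (\<bar>c\<bar> ^ DIM('a)) = 1" if "\<bar>c\<bar> = 1 / 2" for c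
  proof -
    have "2 ^ DIM('a) * ennreal (\<bar>c\<bar> ^ DIM('a)) = ennreal (2 ^ DIM('a) * (1 / 2) ^ DIM('a))"
      unfolding that by (subst ennreal_mult) (auto simp flip: ennreal_power)
    then show ?thesis by (simp add: power_mult_distrib[symmetric])
  qed
  show "(\<integral>\<^sup>+x. f (t + x /\<^sub>R 2) \<partial>nlborel) = 2 ^ DIM('a) * (\<integral>\<^sup>+x. f x \<partial>nlborel)"
    using nn_integral_nlborel_affine[of f "1 / 2" t, symmetric] *[of "1 / 2"]
    by (simp add: mult.assoc[symmetric] inverse_eq_divide)
  show "(\<integral>\<^sup>+x. f (t - x /\<^sub>R 2) \<partial>nlborel) = 2 ^ DIM('a) * (\<integral>\<^sup>+x. f x \<partial>nlborel)"
    using nn_integral_nlborel_affine[of f "- 1 / 2" t, symmetric] *[of "- 1 / 2"]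
    by (simp add: mult.assoc[symmetric] inverse_eq_divide)
qed

lemma nn_integral_convolution:
  fixes F G :: "'a::euclidean_space \<Rightarrow> ennreal"
  assumes [measurable]: "F \<in> borel_measurable borel" "G \<in> borel_measurable borel"
  shows "(\<integral>\<^sup>+p. \<integral>\<^sup>+r. F r * G (p - r) \<partial>nlborel \<partial>nlborel) = (\<integral>\<^sup>+x. F x \<partial>nlborel) * (\<integral>\<^sup>+x. G x \<partial>nlborel)"
proof -
  have "(\<integral>\<^sup>+p. \<integral>\<^sup>+r. F r * G (p - r) \<partial>nlborel \<partial>nlborel) = (\<integral>\<^sup>+r. \<integral>\<^sup>+p. F r * G (p - r) \<partial>nlborel \<partial>nlborel)"
    by (rule nn_integral_nlborel_swap) simp
  also have "\<dots> = (\<integral>\<^sup>+r. F r * (\<integral>\<^sup>+x. G x \<partial>nlborel) \<partial>nlborel)"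
  proof (rule nn_integral_cong)
    fix r :: 'a
    show "(\<integral>\<^sup>+p. F r * G (p - r) \<partial>nlborel) = F r * (\<integral>\<^sup>+x. G x \<partial>nlborel)"
      using nn_integral_nlborel_plus[of G "- r"] by (simp add: nn_integral_cmult)
  qed
  finally show ?thesis by (simp add: nn_integral_multc)
qed

text \<open>The map sending \<open>(x, t)\<close> to
  \<open>(x + t /\<^sub>R 2, x - t /\<^sub>R 2)\<close> has Jacobian of modulus 1; the substitution
  is done one variable at a time.\<close>

lemma nn_integral_midpoint:
  fixes F G :: "'a::euclidean_space \<Rightarrow> ennreal"
  assumes [measurable]: "F \<in> borel_measurable borel" "G \<in> borel_measurable borel"
  shows "(\<integral>\<^sup>+x. \<integral>\<^sup>+t. F (x + t /\<^sub>R 2) * G (x - t /\<^sub>R 2) \<partial>nlborel \<partial>nlborel)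
    = (\<integral>\<^sup>+x. F x \<partial>nlborel) * (\<integral>\<^sup>+x. G x \<partial>nlborel)"
proof -
  have "(\<integral>\<^sup>+x. \<integral>\<^sup>+t. F (x + t /\<^sub>R 2) * G (x - t /\<^sub>R 2) \<partial>nlborel \<partial>nlborel)
      = (\<integral>\<^sup>+t. \<integral>\<^sup>+x. F (x + t /\<^sub>R 2) * G (x - t /\<^sub>R 2) \<partial>nlborel \<partial>nlborel)"
    by (rule nn_integral_nlborel_swap) simp
  also have "\<dots> = (\<integral>\<^sup>+t. \<integral>\<^sup>+x. F x * G (x - t) \<partial>nlborel \<partial>nlborel)"
  proof (rule nn_integral_cong)
    fix t :: 'a
    have eq: "x - t /\<^sub>R 2 = (t /\<^sub>R 2 + x) - t" "x + t /\<^sub>R 2 = t /\<^sub>R 2 + x" for x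
      by (simp_all add: algebra_simps flip: scaleR_left_distrib)
    show "(\<integral>\<^sup>+x. F (x + t /\<^sub>R 2) * G (x - t /\<^sub>R 2) \<partial>nlborel) = (\<integral>\<^sup>+x. F x * G (x - t) \<partial>nlborel)"
      unfolding eq(1) unfolding eq(2) by (rule nn_integral_nlborel_plus) simp
  qed
  also have "\<dots> = (\<integral>\<^sup>+x. \<integral>\<^sup>+t. F x * G (x - t) \<partial>nlborel \<partial>nlborel)"
    by (rule nn_integral_nlborel_swap[symmetric]) simp
  also have "\<dots> = (\<integral>\<^sup>+x. F x * (\<integral>\<^sup>+t. G t \<partial>nlborel) \<partial>nlborel)"
    by (intro nn_integral_cong) (simp add: nn_integral_cmult nn_integral_nlborel_minus)
  finally show ?thesis by (simp add: nn_integral_multc)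
qed

text \<open>The arguments of \<open>F1\<close> and \<open>F2\<close> add up to
  \<open>2 x + u / 2\<close>, those of \<open>G1\<close> and \<open>G2\<close> to
  \<open>2 x - u / 2\<close>, both independent of \<open>s\<close>. So after Cauchy-Schwarz the two
  integrals over \<open>s\<close> are convolutions of squares at these points, and the integral over
  \<open>x\<close> and \<open>u\<close> factors by \<open>nn_integral_midpoint\<close>. The two
  substitutions in \<open>s\<close> cost \<open>2 ^ DIM('a)\<close> each, and rescaling
  \<open>x\<close> to \<open>2 x\<close> gives one of them back.\<close>

lemma quadrilinear_bound:
  fixes F1 F2 G1 G2 :: "'a::euclidean_space \<Rightarrow> ennreal"
  assumes [measurable]: "F1 \<in> borel_measurable borel" "G1 \<in> borel_measurable borel"
    "F2 \<in> borel_measurable borel" "G2 \<in> borel_measurable borel"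
  shows "(\<integral>\<^sup>+x. \<integral>\<^sup>+u. (\<integral>\<^sup>+s. (F1 (x + s /\<^sub>R 2) * G1 (x - s /\<^sub>R 2)) *
        (F2 (x + (u - s) /\<^sub>R 2) * G2 (x - (u - s) /\<^sub>R 2)) \<partial>nlborel)\<^sup>2 \<partial>nlborel \<partial>nlborel)
    \<le> 2 ^ DIM('a) * (((\<integral>\<^sup>+x. (F1 x)\<^sup>2 \<partial>nlborel) * (\<integral>\<^sup>+x. (G1 x)\<^sup>2 \<partial>nlborel)) *
        ((\<integral>\<^sup>+x. (F2 x)\<^sup>2 \<partial>nlborel) * (\<integral>\<^sup>+x. (G2 x)\<^sup>2 \<partial>nlborel)))"
proof -
  define \<Phi> where "\<Phi> p = (\<integral>\<^sup>+r. (F1 r)\<^sup>2 * (F2 (p - r))\<^sup>2 \<partial>nlborel)" for p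
  define \<Gamma> where "\<Gamma> q = (\<integral>\<^sup>+r. (G1 r)\<^sup>2 * (G2 (q - r))\<^sup>2 \<partial>nlborel)" for q
  have [measurable]: "\<Phi> \<in> borel_measurable borel" "\<Gamma> \<in> borel_measurable borel"
    unfolding \<Phi>_def \<Gamma>_def by measurable
  have two: "x + (u - s) /\<^sub>R 2 = (2 *\<^sub>R x + u /\<^sub>R 2) - (x + s /\<^sub>R 2)"
    "x - (u - s) /\<^sub>R 2 = (2 *\<^sub>R x - u /\<^sub>R 2) - (x - s /\<^sub>R 2)" for x u s :: 'a
    by (simp_all add: algebra_simps scaleR_2)
  have "(\<integral>\<^sup>+s. (F1 (x + s /\<^sub>R 2) * G1 (x - s /\<^sub>R 2)) *
        (F2 (x + (u - s) /\<^sub>R 2) * G2 (x - (u - s) /\<^sub>R 2)) \<partial>nlborel)\<^sup>2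
      \<le> (2 ^ DIM('a) * \<Phi> (2 *\<^sub>R x + u /\<^sub>R 2)) * (2 ^ DIM('a) * \<Gamma> (2 *\<^sub>R x - u /\<^sub>R 2))" for x u
  proof -
    have "(\<integral>\<^sup>+s. (F1 (x + s /\<^sub>R 2) * G1 (x - s /\<^sub>R 2)) *
        (F2 (x + (u - s) /\<^sub>R 2) * G2 (x - (u - s) /\<^sub>R 2)) \<partial>nlborel)\<^sup>2
      = (\<integral>\<^sup>+s. (F1 (x + s /\<^sub>R 2) * F2 (x + (u - s) /\<^sub>R 2)) *
        (G1 (x - s /\<^sub>R 2) * G2 (x - (u - s) /\<^sub>R 2)) \<partial>nlborel)\<^sup>2"
      by (simp add: mult_ac)
    also have "\<dots> \<le> (\<integral>\<^sup>+s. (F1 (x + s /\<^sub>R 2) * F2 (x + (u - s) /\<^sub>R 2))\<^sup>2 \<partial>nlborel) *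
        (\<integral>\<^sup>+s. (G1 (x - s /\<^sub>R 2) * G2 (x - (u - s) /\<^sub>R 2))\<^sup>2 \<partial>nlborel)"
      by (rule Cauchy_Schwarz_nn_integral) measurable
    also have "(\<integral>\<^sup>+s. (F1 (x + s /\<^sub>R 2) * F2 (x + (u - s) /\<^sub>R 2))\<^sup>2 \<partial>nlborel) = 2 ^ DIM('a) * \<Phi> (2 *\<^sub>R x + u /\<^sub>R 2)"
      unfolding two \<Phi>_def power_mult_distrib
      by (rule nn_integral_nlborel_half(1)[where f = "\<lambda>r. (F1 r)\<^sup>2 * (F2 (2 *\<^sub>R x + u /\<^sub>R 2 - r))\<^sup>2"]) measurable
    also have "(\<integral>\<^sup>+s. (G1 (x - s /\<^sub>R 2) * G2 (x - (u - s) /\<^sub>R 2))\<^sup>2 \<partial>nlborel) = 2 ^ DIM('a) * \<Gamma> (2 *\<^sub>R x - u /\<^sub>R 2)"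
      unfolding two \<Gamma>_def power_mult_distrib
      by (rule nn_integral_nlborel_half(2)[where f = "\<lambda>r. (G1 r)\<^sup>2 * (G2 (2 *\<^sub>R x - u /\<^sub>R 2 - r))\<^sup>2"]) measurable
    finally show ?thesis .
  qed
  then have "(\<integral>\<^sup>+x. \<integral>\<^sup>+u. (\<integral>\<^sup>+s. (F1 (x + s /\<^sub>R 2) * G1 (x - s /\<^sub>R 2)) *
        (F2 (x + (u - s) /\<^sub>R 2) * G2 (x - (u - s) /\<^sub>R 2)) \<partial>nlborel)\<^sup>2 \<partial>nlborel \<partial>nlborel)
      \<le> (\<integral>\<^sup>+x. \<integral>\<^sup>+u. (2 ^ DIM('a) * \<Phi> (2 *\<^sub>R x + u /\<^sub>R 2)) * (2 ^ DIM('a) * \<Gamma> (2 *\<^sub>R x - u /\<^sub>R 2)) \<partial>nlborel \<partial>nlborel)"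
    by (intro nn_integral_mono)
  also have "\<dots> = (\<integral>\<^sup>+x. 4 ^ DIM('a) * (\<integral>\<^sup>+u. \<Phi> (2 *\<^sub>R x + u /\<^sub>R 2) * \<Gamma> (2 *\<^sub>R x - u /\<^sub>R 2) \<partial>nlborel) \<partial>nlborel)"
    by (simp add: nn_integral_cmult[symmetric] mult_ac flip: power_mult_distrib)
       (simp add: mult.left_commute mult.assoc[symmetric] flip: power_mult_distrib)
  also have "\<dots> = 4 ^ DIM('a) * (\<integral>\<^sup>+x. (\<integral>\<^sup>+u. \<Phi> (2 *\<^sub>R x + u /\<^sub>R 2) * \<Gamma> (2 *\<^sub>R x - u /\<^sub>R 2) \<partial>nlborel) \<partial>nlborel)"
    by (simp add: nn_integral_cmult)
  \<comment> \<open>The inner power of 2 is split off to be absorbed by the substitution of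
    \<open>x\<close> for \<open>2 x\<close>.\<close>
  also have "\<dots> = 2 ^ DIM('a) * (2 ^ DIM('a) * (\<integral>\<^sup>+x. (\<integral>\<^sup>+u. \<Phi> (2 *\<^sub>R x + u /\<^sub>R 2) * \<Gamma> (2 *\<^sub>R x - u /\<^sub>R 2) \<partial>nlborel) \<partial>nlborel))"
    by (simp add: mult.assoc[symmetric] flip: power_mult_distrib)
  also have "2 ^ DIM('a) * (\<integral>\<^sup>+x. (\<integral>\<^sup>+u. \<Phi> (2 *\<^sub>R x + u /\<^sub>R 2) * \<Gamma> (2 *\<^sub>R x - u /\<^sub>R 2) \<partial>nlborel) \<partial>nlborel)
      = (\<integral>\<^sup>+x. (\<integral>\<^sup>+u. \<Phi> (x + u /\<^sub>R 2) * \<Gamma> (x - u /\<^sub>R 2) \<partial>nlborel) \<partial>nlborel)"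
    using nn_integral_nlborel_affine[of "\<lambda>x. \<integral>\<^sup>+u. \<Phi> (x + u /\<^sub>R 2) * \<Gamma> (x - u /\<^sub>R 2) \<partial>nlborel" 2 0]
    by (simp flip: ennreal_power)
  also have "\<dots> = (\<integral>\<^sup>+p. \<Phi> p \<partial>nlborel) * (\<integral>\<^sup>+q. \<Gamma> q \<partial>nlborel)"
    by (rule nn_integral_midpoint) measurable
  also have "(\<integral>\<^sup>+p. \<Phi> p \<partial>nlborel) = (\<integral>\<^sup>+x. (F1 x)\<^sup>2 \<partial>nlborel) * (\<integral>\<^sup>+x. (F2 x)\<^sup>2 \<partial>nlborel)"
    unfolding \<Phi>_def by (rule nn_integral_convolution) measurable
  also have "(\<integral>\<^sup>+q. \<Gamma> q \<partial>nlborel) = (\<integral>\<^sup>+x. (G1 x)\<^sup>2 \<partial>nlborel) * (\<integral>\<^sup>+x. (G2 x)\<^sup>2 \<partial>nlborel)"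
    unfolding \<Gamma>_def by (rule nn_integral_convolution) measurable
  finally show ?thesis by (simp add: mult_ac)
qed

lemma norm_quat_cnj [simp]: "norm (quat_cnj x) = norm x"
  by (simp add: norm_quat_def quat_cnj_def)

lemma quat_cnj_measurable [measurable]: "quat_cnj \<in> borel_measurable borel"
proof -
  have "bounded_linear quat_cnj"
    unfolding linear_conv_bounded_linear[symmetric]
    by (rule linearI) (simp_all add: quat_cnj_def quat_eq_iff)
  then show ?thesis
    by (intro borel_measurable_continuous_onI linear_continuous_on)
qed

text \<open>Two pairs of functions occur because the convolution in the second block multiplies
  transforms of slices of \<open>f\<close> and \<open>g\<close> taken at different points of that
  block.\<close>

lemma partial_wigner_bound:
  fixes f1 f2 g1 g2 :: "'a::euclidean_space \<Rightarrow> quat"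
  assumes [measurable]: "f1 \<in> borel_measurable borel" "g1 \<in> borel_measurable borel"
    "f2 \<in> borel_measurable borel" "g2 \<in> borel_measurable borel"
  shows "(\<integral>\<^sup>+x. \<integral>\<^sup>+w. ennreal ((norm (lfourier (\<lambda>t. f1 (x + t /\<^sub>R 2) * quat_cnj (g1 (x - t /\<^sub>R 2))) w))\<^sup>2 *
        (norm (lfourier (\<lambda>t. f2 (x + t /\<^sub>R 2) * quat_cnj (g2 (x - t /\<^sub>R 2))) w))\<^sup>2) \<partial>nlborel \<partial>nlborel)
    \<le> 2 ^ DIM('a) * (((\<integral>\<^sup>+x. (ennreal (norm (f1 x)))\<^sup>2 \<partial>nlborel) * (\<integral>\<^sup>+x. (ennreal (norm (g1 x)))\<^sup>2 \<partial>nlborel)) *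
        ((\<integral>\<^sup>+x. (ennreal (norm (f2 x)))\<^sup>2 \<partial>nlborel) * (\<integral>\<^sup>+x. (ennreal (norm (g2 x)))\<^sup>2 \<partial>nlborel)))"
proof -
  have "(\<integral>\<^sup>+x. \<integral>\<^sup>+w. ennreal ((norm (lfourier (\<lambda>t. f1 (x + t /\<^sub>R 2) * quat_cnj (g1 (x - t /\<^sub>R 2))) w))\<^sup>2 *
        (norm (lfourier (\<lambda>t. f2 (x + t /\<^sub>R 2) * quat_cnj (g2 (x - t /\<^sub>R 2))) w))\<^sup>2) \<partial>nlborel \<partial>nlborel)
    \<le> (\<integral>\<^sup>+x. \<integral>\<^sup>+u. (\<integral>\<^sup>+s. (ennreal (norm (f1 (x + s /\<^sub>R 2))) * ennreal (norm (g1 (x - s /\<^sub>R 2)))) *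
        (ennreal (norm (f2 (x + (u - s) /\<^sub>R 2))) * ennreal (norm (g2 (x - (u - s) /\<^sub>R 2)))) \<partial>nlborel)\<^sup>2 \<partial>nlborel \<partial>nlborel)"
  proof (rule nn_integral_mono)
    fix x :: 'a
    show "(\<integral>\<^sup>+w. ennreal ((norm (lfourier (\<lambda>t. f1 (x + t /\<^sub>R 2) * quat_cnj (g1 (x - t /\<^sub>R 2))) w))\<^sup>2 *
        (norm (lfourier (\<lambda>t. f2 (x + t /\<^sub>R 2) * quat_cnj (g2 (x - t /\<^sub>R 2))) w))\<^sup>2) \<partial>nlborel)
      \<le> (\<integral>\<^sup>+u. (\<integral>\<^sup>+s. (ennreal (norm (f1 (x + s /\<^sub>R 2))) * ennreal (norm (g1 (x - s /\<^sub>R 2)))) *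
        (ennreal (norm (f2 (x + (u - s) /\<^sub>R 2))) * ennreal (norm (g2 (x - (u - s) /\<^sub>R 2)))) \<partial>nlborel)\<^sup>2 \<partial>nlborel)"
      using lfourier_mult_bound[of "\<lambda>t. f1 (x + t /\<^sub>R 2) * quat_cnj (g1 (x - t /\<^sub>R 2))"
          "\<lambda>t. f2 (x + t /\<^sub>R 2) * quat_cnj (g2 (x - t /\<^sub>R 2))"]
      by (simp add: norm_mult ennreal_mult)
  qed
  also have "\<dots> \<le> 2 ^ DIM('a) * (((\<integral>\<^sup>+x. (ennreal (norm (f1 x)))\<^sup>2 \<partial>nlborel) * (\<integral>\<^sup>+x. (ennreal (norm (g1 x)))\<^sup>2 \<partial>nlborel)) *
        ((\<integral>\<^sup>+x. (ennreal (norm (f2 x)))\<^sup>2 \<partial>nlborel) * (\<integral>\<^sup>+x. (ennreal (norm (g2 x)))\<^sup>2 \<partial>nlborel)))"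
    by (rule quadrilinear_bound) measurable
  finally show ?thesis .
qed

text \<open>The value at \<open>top\<close> is separate because \<open>enn2real top\<close> is
  \<open>0\<close>; with it, squaring inverts the root without exception.\<close>

definition ennsqrt :: "ennreal \<Rightarrow> ennreal" where
  "ennsqrt x = (if x = top then top else ennreal (sqrt (enn2real x)))"

lemma ennsqrt_measurable [measurable]: "ennsqrt \<in> borel_measurable borel"
  unfolding ennsqrt_def by measurable

lemma ennsqrt_power2 [simp]: "(ennsqrt x)\<^sup>2 = x"
proof (cases x)
  case (real r)
  then show ?thesis by (simp add: ennsqrt_def ennreal_power)
next
  case top
  then show ?thesis by (simp add: ennsqrt_def power2_eq_square)
qed

text \<open>The square of the inner integral is a double integral over \<open>s\<close> and
  \<open>s'\<close>. After exchanging the order, Cauchy-Schwarz in \<open>z\<close> bounds each pair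
  by \<open>M s * M s'\<close>, and the double integral of this product is a square again.\<close>

lemma nn_integral_Minkowski:
  fixes K :: "'a::euclidean_space \<Rightarrow> 'b::euclidean_space \<Rightarrow> ennreal"
  assumes [measurable]: "(\<lambda>p. K (fst p) (snd p)) \<in> borel_measurable borel" "M \<in> borel_measurable borel"
    and le: "\<And>s. (\<integral>\<^sup>+z. (K s z)\<^sup>2 \<partial>nlborel) \<le> (M s)\<^sup>2"
  shows "(\<integral>\<^sup>+z. (\<integral>\<^sup>+s. K s z \<partial>nlborel)\<^sup>2 \<partial>nlborel) \<le> (\<integral>\<^sup>+s. M s \<partial>nlborel)\<^sup>2"
proof -
  have K [measurable (raw)]: "(\<lambda>x. K (f x) (g x)) \<in> borel_measurable N"
    if [measurable]: "f \<in> borel_measurable N" "g \<in> borel_measurable N" for f g and N :: "'c measure"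
    using measurable_compose[of "\<lambda>x. (f x, g x)" N borel "\<lambda>p. K (fst p) (snd p)" borel] by simp
  have "(\<integral>\<^sup>+z. (\<integral>\<^sup>+s. K s z \<partial>nlborel)\<^sup>2 \<partial>nlborel)
      = (\<integral>\<^sup>+z. \<integral>\<^sup>+s. \<integral>\<^sup>+s'. K s z * K s' z \<partial>nlborel \<partial>nlborel \<partial>nlborel)"
    by (simp add: power2_eq_square nn_integral_cmult nn_integral_multc K)
  also have "\<dots> = (\<integral>\<^sup>+s. \<integral>\<^sup>+z. \<integral>\<^sup>+s'. K s z * K s' z \<partial>nlborel \<partial>nlborel \<partial>nlborel)"
    by (rule nn_integral_nlborel_swap) (simp add: K)
  also have "\<dots> = (\<integral>\<^sup>+s. \<integral>\<^sup>+s'. \<integral>\<^sup>+z. K s z * K s' z \<partial>nlborel \<partial>nlborel \<partial>nlborel)"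
    by (rule nn_integral_cong) (rule nn_integral_nlborel_swap, simp add: K)
  also have "\<dots> \<le> (\<integral>\<^sup>+s. \<integral>\<^sup>+s'. M s * M s' \<partial>nlborel \<partial>nlborel)"
  proof (intro nn_integral_mono)
    fix s s' :: 'a
    have "(\<integral>\<^sup>+z. K s z * K s' z \<partial>nlborel)\<^sup>2 \<le> (\<integral>\<^sup>+z. (K s z)\<^sup>2 \<partial>nlborel) * (\<integral>\<^sup>+z. (K s' z)\<^sup>2 \<partial>nlborel)"
      by (rule Cauchy_Schwarz_nn_integral) (simp_all add: K)
    also have "\<dots> \<le> (M s)\<^sup>2 * (M s')\<^sup>2"
      by (intro mult_mono le) auto
    also have "\<dots> = (M s * M s')\<^sup>2"
      by (simp add: power_mult_distrib)
    finally show "(\<integral>\<^sup>+z. K s z * K s' z \<partial>nlborel) \<le> M s * M s'"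
      by (simp add: ennreal_power2_le_iff)
  qed
  also have "\<dots> = (\<integral>\<^sup>+s. M s \<partial>nlborel)\<^sup>2"
    by (simp add: power2_eq_square nn_integral_cmult nn_integral_multc)
  finally show ?thesis .
qed

section \<open>The Wigner transform\<close>

lemma nlborel_Fubini_snd:
  fixes f :: "'a::euclidean_space \<times> 'b::euclidean_space \<Rightarrow> 'c::{banach, second_countable_topology}"
  assumes "integrable nlborel f"
  shows "integrable nlborel (\<lambda>y. \<integral>x. f (x, y) \<partial>nlborel)"
    and "AE y in nlborel. integrable nlborel (\<lambda>x. f (x, y))"
proof -
  have *: "integrable (nlborel \<Otimes>\<^sub>M nlborel) (\<lambda>(x, y). f (x, y))"
    using assms by (simp add: nlborel_prod)
  show "integrable nlborel (\<lambda>y. \<integral>x. f (x, y) \<partial>nlborel)"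
    by (rule nlborel_pair.integrable_snd[OF *])
  show "AE y in nlborel. integrable nlborel (\<lambda>x. f (x, y))"
    by (rule nlborel_pair.AE_integrable_snd[OF *])
qed

definition cross :: "('a::euclidean_space \<Rightarrow> quat) \<Rightarrow> ('a \<Rightarrow> quat) \<Rightarrow> 'a \<Rightarrow> 'a \<Rightarrow> quat" where
  "cross f g x t = f (x + t /\<^sub>R 2) * quat_cnj (g (x - t /\<^sub>R 2))"

lemma cross_measurable [measurable (raw)]:
  assumes [measurable]: "f \<in> borel_measurable borel" "g \<in> borel_measurable borel"
    "X \<in> borel_measurable M" "T \<in> borel_measurable M"
  shows "(\<lambda>z. cross f g (X z) (T z)) \<in> borel_measurable M"
  unfolding cross_def by measurable

lemma norm_cross: "norm (cross f g x t) = norm (f (x + t /\<^sub>R 2)) * norm (g (x - t /\<^sub>R 2))"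
  by (simp add: cross_def norm_mult)

text \<open>The left transform in the first block of \<open>t\<close> only; \<open>s\<close> is the untransformed second block.\<close>

definition pwigner :: "('a::euclidean_space \<times> 'a \<Rightarrow> quat) \<Rightarrow> ('a \<times> 'a \<Rightarrow> quat) \<Rightarrow> 'a \<times> 'a \<Rightarrow> 'a \<Rightarrow> 'a \<Rightarrow> quat" where
  "pwigner f g x s w = lfourier (\<lambda>t. cross f g x (t, s)) w"

lemma pwigner_measurable [measurable (raw)]:
  assumes [measurable]: "f \<in> borel_measurable borel" "g \<in> borel_measurable borel"
    "X \<in> borel_measurable M" "S \<in> borel_measurable M" "W \<in> borel_measurable M"
  shows "(\<lambda>z. pwigner f g (X z) (S z) (W z)) \<in> borel_measurable M"
  unfolding pwigner_def lfourier_def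
  by (rule nlborel.borel_measurable_lebesgue_integral) measurable

text \<open>The Borel counterpart of \<open>wigner\<close>, used for Borel representatives of
  \<open>f\<close> and \<open>g\<close>.\<close>

definition nwigner :: "('a::euclidean_space \<times> 'a \<Rightarrow> quat) \<Rightarrow> ('a \<times> 'a \<Rightarrow> quat) \<Rightarrow> 'a \<times> 'a \<Rightarrow> 'a \<times> 'a \<Rightarrow> quat" where
  "nwigner f g x w = (\<integral>t. exp (- ((fst w \<bullet> fst t) *\<^sub>R quat_i)) * cross f g x t * exp (- ((snd w \<bullet> snd t) *\<^sub>R quat_j)) \<partial>nlborel)"

lemma nwigner_measurable [measurable (raw)]:
  assumes [measurable]: "f \<in> borel_measurable borel" "g \<in> borel_measurable borel"
    "X \<in> borel_measurable M" "W \<in> borel_measurable M"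
  shows "(\<lambda>z. nwigner f g (X z) (W z)) \<in> borel_measurable M"
  unfolding nwigner_def
  by (rule nlborel.borel_measurable_lebesgue_integral) measurable

text \<open>Cauchy-Schwarz in \<open>t\<close> works at every \<open>x\<close>, not only at almost
  every one, so the integral defining the transform converges everywhere.\<close>

lemma integrable_cross:
  fixes f g :: "'a::euclidean_space \<Rightarrow> quat"
  assumes [measurable]: "f \<in> borel_measurable borel" "g \<in> borel_measurable borel"
    and f: "(\<integral>\<^sup>+x. (ennreal (norm (f x)))\<^sup>2 \<partial>nlborel) < \<infinity>" and g: "(\<integral>\<^sup>+x. (ennreal (norm (g x)))\<^sup>2 \<partial>nlborel) < \<infinity>"
  shows "integrable nlborel (cross f g x)"
proof (rule integrableI_bounded)
  have "(\<integral>\<^sup>+t. ennreal (norm (cross f g x t)) \<partial>nlborel)\<^sup>2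
      = (\<integral>\<^sup>+t. ennreal (norm (f (x + t /\<^sub>R 2))) * ennreal (norm (g (x - t /\<^sub>R 2))) \<partial>nlborel)\<^sup>2"
    by (simp add: norm_cross ennreal_mult)
  also have "\<dots> \<le> (\<integral>\<^sup>+t. (ennreal (norm (f (x + t /\<^sub>R 2))))\<^sup>2 \<partial>nlborel) * (\<integral>\<^sup>+t. (ennreal (norm (g (x - t /\<^sub>R 2))))\<^sup>2 \<partial>nlborel)"
    by (rule Cauchy_Schwarz_nn_integral) measurable
  also have "(\<integral>\<^sup>+t. (ennreal (norm (f (x + t /\<^sub>R 2))))\<^sup>2 \<partial>nlborel) = 2 ^ DIM('a) * (\<integral>\<^sup>+x. (ennreal (norm (f x)))\<^sup>2 \<partial>nlborel)"
    by (rule nn_integral_nlborel_half(1)[where f = "\<lambda>x. (ennreal (norm (f x)))\<^sup>2"]) measurable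
  also have "(\<integral>\<^sup>+t. (ennreal (norm (g (x - t /\<^sub>R 2))))\<^sup>2 \<partial>nlborel) = 2 ^ DIM('a) * (\<integral>\<^sup>+x. (ennreal (norm (g x)))\<^sup>2 \<partial>nlborel)"
    by (rule nn_integral_nlborel_half(2)[where f = "\<lambda>x. (ennreal (norm (g x)))\<^sup>2"]) measurable
  also have "(2 ^ DIM('a) * (\<integral>\<^sup>+x. (ennreal (norm (f x)))\<^sup>2 \<partial>nlborel)) * (2 ^ DIM('a) * (\<integral>\<^sup>+x. (ennreal (norm (g x)))\<^sup>2 \<partial>nlborel)) < \<infinity>"
    using f g by (simp add: ennreal_mult_less_top power_less_top_ennreal)
  finally show "(\<integral>\<^sup>+t. ennreal (norm (cross f g x t)) \<partial>nlborel) < \<infinity>"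
    by (simp add: power_less_top_ennreal)
qed simp

text \<open>The left kernel depends on the first block of \<open>t\<close> only and the right kernel
  on the second only, so Fubini turns the two-sided transform into a left transform followed by a
  right one.\<close>

lemma nwigner_eq_rfourier:
  fixes f g :: "'a::euclidean_space \<times> 'a \<Rightarrow> quat"
  assumes i: "integrable nlborel (cross f g x)" and [measurable]: "f \<in> borel_measurable borel" "g \<in> borel_measurable borel"
  shows "nwigner f g x w = rfourier (\<lambda>s. pwigner f g x s (fst w)) (snd w)"
proof -
  define H where "H t = exp (- ((fst w \<bullet> fst t) *\<^sub>R quat_i)) * cross f g x t * exp (- ((snd w \<bullet> snd t) *\<^sub>R quat_j))" for t
  have [measurable]: "H \<in> borel_measurable borel"
    unfolding H_def by measurable
  have "integrable nlborel H"
    using i by (rule Bochner_Integration.integrable_bound) (auto simp: H_def norm_mult)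
  note Fub = nlborel_Fubini(2)[OF this]
  have "nwigner f g x w = (\<integral>z. H z \<partial>nlborel)"
    by (simp add: nwigner_def H_def)
  also note Fub[symmetric]
  also have "(\<lambda>s. \<integral>t. H (t, s) \<partial>nlborel) = (\<lambda>s. pwigner f g x s (fst w) * exp (- ((snd w \<bullet> s) *\<^sub>R quat_j)))"
  proof
    fix s
    define e where "e = exp (- ((snd w \<bullet> s) *\<^sub>R quat_j))"
    \<comment> \<open>The slice in \<open>t\<close> is known to be integrable only for almost every
      \<open>s\<close>. Invertibility of \<open>e\<close> lets the factor leave the integral for
      every \<open>s\<close>.\<close>
    have "e \<noteq> 0"
      using norm_exp_quat(4)[of "snd w \<bullet> s"] by (auto simp: e_def)
    then have "(\<integral>t. exp (- ((fst w \<bullet> t) *\<^sub>R quat_i)) * cross f g x (t, s) * e \<partial>nlborel)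
        = (\<integral>t. exp (- ((fst w \<bullet> t) *\<^sub>R quat_i)) * cross f g x (t, s) \<partial>nlborel) * e"
      by (intro integral_bounded_linear'[OF bounded_linear_mult_left bounded_linear_mult_left[of "inverse e"]])
         (simp add: mult.assoc)
    then show "(\<integral>t. H (t, s) \<partial>nlborel) = pwigner f g x s (fst w) * exp (- ((snd w \<bullet> s) *\<^sub>R quat_j))"
      by (simp add: H_def pwigner_def lfourier_def e_def)
  qed
  finally show ?thesis
    by (simp add: rfourier_def)
qed

lemma integrable_pwigner:
  fixes f g :: "'a::euclidean_space \<times> 'a \<Rightarrow> quat"
  assumes i: "integrable nlborel (cross f g x)" and [measurable]: "f \<in> borel_measurable borel" "g \<in> borel_measurable borel"
  shows "integrable nlborel (\<lambda>s. pwigner f g x s w)"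
proof -
  have "integrable nlborel (\<lambda>t. exp (- ((w \<bullet> fst t) *\<^sub>R quat_i)) * cross f g x t)"
    using i by (rule Bochner_Integration.integrable_bound) (auto simp: norm_mult)
  from nlborel_Fubini_snd(1)[OF this] show ?thesis
    by (simp add: pwigner_def lfourier_def)
qed

text \<open>The slices satisfy the hypotheses of Plancherel only almost everywhere, which suffices
  under the outer integral. Finiteness of the double integral makes almost every slice square
  integrable, in each of the two rounds; integrability comes from Fubini in the first round and from
  \<open>integrable_pwigner\<close> in the second.\<close>

lemma nwigner_plancherel:
  fixes f g :: "'a::euclidean_space \<times> 'a \<Rightarrow> quat"
  assumes i: "integrable nlborel (cross f g x)" and [measurable]: "f \<in> borel_measurable borel" "g \<in> borel_measurable borel"
    and fin: "(\<integral>\<^sup>+t. ennreal ((norm (cross f g x t))\<^sup>2) \<partial>nlborel) < \<infinity>"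
  shows "(\<integral>\<^sup>+w. ennreal ((norm (nwigner f g x w))\<^sup>2) \<partial>nlborel) = (\<integral>\<^sup>+t. ennreal ((norm (cross f g x t))\<^sup>2) \<partial>nlborel)"
proof -
  have "(\<integral>\<^sup>+t. ennreal ((norm (cross f g x t))\<^sup>2) \<partial>nlborel) = (\<integral>\<^sup>+t. \<integral>\<^sup>+s. ennreal ((norm (cross f g x (t, s)))\<^sup>2) \<partial>nlborel \<partial>nlborel)"
    by (rule nn_integral_nlborel_fst) measurable
  also have "\<dots> = (\<integral>\<^sup>+s. \<integral>\<^sup>+t. ennreal ((norm (cross f g x (t, s)))\<^sup>2) \<partial>nlborel \<partial>nlborel)"
    by (rule nn_integral_nlborel_swap) measurable
  finally have eq: "(\<integral>\<^sup>+t. ennreal ((norm (cross f g x t))\<^sup>2) \<partial>nlborel) = (\<integral>\<^sup>+s. \<integral>\<^sup>+t. ennreal ((norm (cross f g x (t, s)))\<^sup>2) \<partial>nlborel \<partial>nlborel)" .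
  have "AE s in nlborel. (\<integral>\<^sup>+t. ennreal ((norm (cross f g x (t, s)))\<^sup>2) \<partial>nlborel) \<noteq> \<infinity>"
    using fin unfolding eq by (intro nn_integral_PInf_AE) auto
  then have "AE s in nlborel. (\<integral>\<^sup>+t. ennreal ((norm (cross f g x (t, s)))\<^sup>2) \<partial>nlborel) = (\<integral>\<^sup>+w. ennreal ((norm (pwigner f g x s w))\<^sup>2) \<partial>nlborel)"
    using nlborel_Fubini_snd(2)[OF i]
  proof eventually_elim
    case (elim s)
    have "integrable nlborel (\<lambda>t. (norm (cross f g x (t, s)))\<^sup>2)"
      using elim(1) by (intro integrableI_bounded) (auto simp: top.not_eq_extremum)
    with elim(2) show ?case
      unfolding pwigner_def by (rule lfourier_plancherel[symmetric])
  qed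
  then have "(\<integral>\<^sup>+t. ennreal ((norm (cross f g x t))\<^sup>2) \<partial>nlborel) = (\<integral>\<^sup>+s. \<integral>\<^sup>+w. ennreal ((norm (pwigner f g x s w))\<^sup>2) \<partial>nlborel \<partial>nlborel)"
    unfolding eq by (rule nn_integral_cong_AE)
  also have "\<dots> = (\<integral>\<^sup>+w. \<integral>\<^sup>+s. ennreal ((norm (pwigner f g x s w))\<^sup>2) \<partial>nlborel \<partial>nlborel)"
    by (rule nn_integral_nlborel_swap) measurable
  finally have eq2: "(\<integral>\<^sup>+t. ennreal ((norm (cross f g x t))\<^sup>2) \<partial>nlborel) = (\<integral>\<^sup>+w. \<integral>\<^sup>+s. ennreal ((norm (pwigner f g x s w))\<^sup>2) \<partial>nlborel \<partial>nlborel)" .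
  have "AE w in nlborel. (\<integral>\<^sup>+s. ennreal ((norm (pwigner f g x s w))\<^sup>2) \<partial>nlborel) \<noteq> \<infinity>"
    using fin unfolding eq2 by (intro nn_integral_PInf_AE) auto
  then have "AE w in nlborel. (\<integral>\<^sup>+s. ennreal ((norm (pwigner f g x s w))\<^sup>2) \<partial>nlborel)
      = (\<integral>\<^sup>+v. ennreal ((norm (nwigner f g x (w, v)))\<^sup>2) \<partial>nlborel)"
  proof eventually_elim
    case (elim w)
    have "integrable nlborel (\<lambda>s. (norm (pwigner f g x s w))\<^sup>2)"
      using elim by (intro integrableI_bounded) (auto simp: top.not_eq_extremum)
    from rfourier_plancherel[OF integrable_pwigner[OF i] this] show ?case
      by (simp add: nwigner_eq_rfourier[OF i])
  qed
  then have "(\<integral>\<^sup>+w. \<integral>\<^sup>+s. ennreal ((norm (pwigner f g x s w))\<^sup>2) \<partial>nlborel \<partial>nlborel)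
      = (\<integral>\<^sup>+w. \<integral>\<^sup>+v. ennreal ((norm (nwigner f g x (w, v)))\<^sup>2) \<partial>nlborel \<partial>nlborel)"
    by (rule nn_integral_cong_AE)
  also have "\<dots> = (\<integral>\<^sup>+w. ennreal ((norm (nwigner f g x w))\<^sup>2) \<partial>nlborel)"
    by (rule nn_integral_nlborel_fst[symmetric]) measurable
  finally show ?thesis by (simp add: eq2)
qed

text \<open>At a single \<open>x\<close> the square integral of \<open>cross f g x\<close> may be
  infinite. Its integral over \<open>x\<close> is the finite product of the squared norms, so
  Plancherel in \<open>w\<close> is available for almost every \<open>x\<close>.\<close>

lemma nwigner_mass:
  fixes f g :: "'a::euclidean_space \<times> 'a \<Rightarrow> quat"
  assumes [measurable]: "f \<in> borel_measurable borel" "g \<in> borel_measurable borel"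
    and f: "(\<integral>\<^sup>+x. (ennreal (norm (f x)))\<^sup>2 \<partial>nlborel) < \<infinity>" and g: "(\<integral>\<^sup>+x. (ennreal (norm (g x)))\<^sup>2 \<partial>nlborel) < \<infinity>"
  shows "(\<integral>\<^sup>+z. ennreal ((norm (nwigner f g (fst z) (snd z)))\<^sup>2) \<partial>nlborel)
    = (\<integral>\<^sup>+x. (ennreal (norm (f x)))\<^sup>2 \<partial>nlborel) * (\<integral>\<^sup>+x. (ennreal (norm (g x)))\<^sup>2 \<partial>nlborel)"
proof -
  have "(\<integral>\<^sup>+x. \<integral>\<^sup>+t. ennreal ((norm (cross f g x t))\<^sup>2) \<partial>nlborel \<partial>nlborel)
      = (\<integral>\<^sup>+x. \<integral>\<^sup>+t. (ennreal (norm (f (x + t /\<^sub>R 2))))\<^sup>2 * (ennreal (norm (g (x - t /\<^sub>R 2))))\<^sup>2 \<partial>nlborel \<partial>nlborel)"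
    by (simp add: norm_cross power_mult_distrib ennreal_mult ennreal_power)
  also have "\<dots> = (\<integral>\<^sup>+x. (ennreal (norm (f x)))\<^sup>2 \<partial>nlborel) * (\<integral>\<^sup>+x. (ennreal (norm (g x)))\<^sup>2 \<partial>nlborel)"
    by (rule nn_integral_midpoint) measurable
  finally have eq: "(\<integral>\<^sup>+x. \<integral>\<^sup>+t. ennreal ((norm (cross f g x t))\<^sup>2) \<partial>nlborel \<partial>nlborel)
      = (\<integral>\<^sup>+x. (ennreal (norm (f x)))\<^sup>2 \<partial>nlborel) * (\<integral>\<^sup>+x. (ennreal (norm (g x)))\<^sup>2 \<partial>nlborel)" .
  have "AE x in nlborel. (\<integral>\<^sup>+t. ennreal ((norm (cross f g x t))\<^sup>2) \<partial>nlborel) \<noteq> \<infinity>"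
    using f g eq by (intro nn_integral_PInf_AE) (auto simp: ennreal_mult_eq_top_iff)
  then have "AE x in nlborel. (\<integral>\<^sup>+w. ennreal ((norm (nwigner f g x w))\<^sup>2) \<partial>nlborel) = (\<integral>\<^sup>+t. ennreal ((norm (cross f g x t))\<^sup>2) \<partial>nlborel)"
    by eventually_elim (rule nwigner_plancherel, simp_all add: integrable_cross[OF assms] top.not_eq_extremum)
  then have "(\<integral>\<^sup>+x. \<integral>\<^sup>+w. ennreal ((norm (nwigner f g x w))\<^sup>2) \<partial>nlborel \<partial>nlborel) = (\<integral>\<^sup>+x. \<integral>\<^sup>+t. ennreal ((norm (cross f g x t))\<^sup>2) \<partial>nlborel \<partial>nlborel)"
    by (rule nn_integral_cong_AE)
  then show ?thesis
    by (subst nn_integral_nlborel_fst) (simp_all add: eq)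
qed

lemma cross_split:
  "cross f g (x, y) (t, s) = f (x + t /\<^sub>R 2, y + s /\<^sub>R 2) * quat_cnj (g (x - t /\<^sub>R 2, y - s /\<^sub>R 2))"
  by (simp add: cross_def)

text \<open>With \<open>y\<close> and \<open>u\<close> fixed in the second block, the right
  transform gives an integral over \<open>s\<close> inside a square. Minkowski moves the norm in
  \<open>(x, w)\<close> under this integral, where the bound for the first block applies. What is
  left is the same quadrilinear expression in the second block, now in the norms of slices, so the
  block constant \<open>2 ^ DIM('a)\<close> enters twice.\<close>

lemma nwigner_fourth:
  fixes f g :: "'a::euclidean_space \<times> 'a \<Rightarrow> quat"
  assumes [measurable]: "f \<in> borel_measurable borel" "g \<in> borel_measurable borel"
    and f: "(\<integral>\<^sup>+x. (ennreal (norm (f x)))\<^sup>2 \<partial>nlborel) < \<infinity>" and g: "(\<integral>\<^sup>+x. (ennreal (norm (g x)))\<^sup>2 \<partial>nlborel) < \<infinity>"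
  shows "(\<integral>\<^sup>+z. ennreal ((norm (nwigner f g (fst z) (snd z)))\<^sup>2 * (norm (nwigner f g (fst z) (snd z)))\<^sup>2) \<partial>nlborel)
    \<le> 4 ^ DIM('a) * ((\<integral>\<^sup>+x. (ennreal (norm (f x)))\<^sup>2 \<partial>nlborel) * (\<integral>\<^sup>+x. (ennreal (norm (g x)))\<^sup>2 \<partial>nlborel))\<^sup>2"
    (is "?lhs \<le> 4 ^ _ * (?A * ?B)\<^sup>2")
proof -
  \<comment> \<open>The norm of the slice of \<open>f\<close> at the second-block point
    \<open>b\<close>. It may be infinite for some \<open>b\<close>; its square integrates to the
    squared norm of \<open>f\<close>.\<close>
  define \<phi> where "\<phi> b = ennsqrt (\<integral>\<^sup>+a. (ennreal (norm (f (a, b))))\<^sup>2 \<partial>nlborel)" for b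
  define \<gamma> where "\<gamma> b = ennsqrt (\<integral>\<^sup>+a. (ennreal (norm (g (a, b))))\<^sup>2 \<partial>nlborel)" for b
  have [measurable]: "\<phi> \<in> borel_measurable borel" "\<gamma> \<in> borel_measurable borel"
    unfolding \<phi>_def \<gamma>_def by measurable
  have A: "(\<integral>\<^sup>+b. (\<phi> b)\<^sup>2 \<partial>nlborel) = ?A"
    unfolding \<phi>_def ennsqrt_power2
    by (subst nn_integral_nlborel_swap) (simp_all add: nn_integral_nlborel_fst[of "\<lambda>x. (ennreal (norm (f x)))\<^sup>2"])
  have B: "(\<integral>\<^sup>+b. (\<gamma> b)\<^sup>2 \<partial>nlborel) = ?B"
    unfolding \<gamma>_def ennsqrt_power2
    by (subst nn_integral_nlborel_swap) (simp_all add: nn_integral_nlborel_fst[of "\<lambda>x. (ennreal (norm (g x)))\<^sup>2"])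
  \<comment> \<open>\<open>K\<close> is the integrand of the convolution square in the second block,
    with \<open>z\<close> collecting position and frequency of the first block; \<open>r * M\<close>
    will bound its norm in \<open>z\<close>.\<close>
  define K where "K y u s z = ennreal (norm (pwigner f g (fst z, y) s (snd z))) * ennreal (norm (pwigner f g (fst z, y) (u - s) (snd z)))"
    for y u s and z :: "'a \<times> 'a"
  define M where "M y u s = (\<phi> (y + s /\<^sub>R 2) * \<gamma> (y - s /\<^sub>R 2)) * (\<phi> (y + (u - s) /\<^sub>R 2) * \<gamma> (y - (u - s) /\<^sub>R 2))" for y u s
  \<comment> \<open>A root, because \<open>partial_wigner_bound\<close> controls the square of the
    norm while Minkowski wants the norm.\<close>
  define r :: ennreal where "r = ennsqrt (2 ^ DIM('a))"
  have K_M: "(\<integral>\<^sup>+z. (\<integral>\<^sup>+s. K y u s z \<partial>nlborel)\<^sup>2 \<partial>nlborel) \<le> (\<integral>\<^sup>+s. r * M y u s \<partial>nlborel)\<^sup>2" for y u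
  proof (rule nn_integral_Minkowski)
    fix s
    have "(\<integral>\<^sup>+z. (K y u s z)\<^sup>2 \<partial>nlborel) = (\<integral>\<^sup>+x. \<integral>\<^sup>+w. ennreal ((norm (pwigner f g (x, y) s w))\<^sup>2 * (norm (pwigner f g (x, y) (u - s) w))\<^sup>2) \<partial>nlborel \<partial>nlborel)"
      by (subst nn_integral_nlborel_fst) (simp_all add: K_def power_mult_distrib ennreal_mult ennreal_power)
    also have "\<dots> \<le> 2 ^ DIM('a) * (((\<phi> (y + s /\<^sub>R 2))\<^sup>2 * (\<gamma> (y - s /\<^sub>R 2))\<^sup>2) * ((\<phi> (y + (u - s) /\<^sub>R 2))\<^sup>2 * (\<gamma> (y - (u - s) /\<^sub>R 2))\<^sup>2))"
      unfolding pwigner_def cross_split \<phi>_def \<gamma>_def ennsqrt_power2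
      by (rule partial_wigner_bound) measurable
    also have "\<dots> = (r * M y u s)\<^sup>2"
      by (simp add: r_def M_def power_mult_distrib)
    finally show "(\<integral>\<^sup>+z. (K y u s z)\<^sup>2 \<partial>nlborel) \<le> (r * M y u s)\<^sup>2" .
  qed (simp_all add: K_def M_def)
  have rf: "(\<integral>\<^sup>+v. ennreal ((norm (nwigner f g (x, y) (w, v)))\<^sup>2 * (norm (nwigner f g (x, y) (w, v)))\<^sup>2) \<partial>nlborel)
      \<le> (\<integral>\<^sup>+u. (\<integral>\<^sup>+s. K y u s (x, w) \<partial>nlborel)\<^sup>2 \<partial>nlborel)" for x y w
    unfolding nwigner_eq_rfourier[OF integrable_cross[OF assms] assms(1,2)] K_def
    using rfourier_mult_bound[of "\<lambda>s. pwigner f g (x, y) s w" "\<lambda>s. pwigner f g (x, y) s w"] by simp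
  have "?lhs = (\<integral>\<^sup>+x. \<integral>\<^sup>+y. \<integral>\<^sup>+w. \<integral>\<^sup>+v. ennreal ((norm (nwigner f g (x, y) (w, v)))\<^sup>2 * (norm (nwigner f g (x, y) (w, v)))\<^sup>2) \<partial>nlborel \<partial>nlborel \<partial>nlborel \<partial>nlborel)"
    by (simp add: nn_integral_nlborel_fst)
  also have "\<dots> \<le> (\<integral>\<^sup>+x. \<integral>\<^sup>+y. \<integral>\<^sup>+w. \<integral>\<^sup>+u. (\<integral>\<^sup>+s. K y u s (x, w) \<partial>nlborel)\<^sup>2 \<partial>nlborel \<partial>nlborel \<partial>nlborel \<partial>nlborel)"
    by (intro nn_integral_mono rf)
  also have "\<dots> = (\<integral>\<^sup>+y. \<integral>\<^sup>+x. \<integral>\<^sup>+w. \<integral>\<^sup>+u. (\<integral>\<^sup>+s. K y u s (x, w) \<partial>nlborel)\<^sup>2 \<partial>nlborel \<partial>nlborel \<partial>nlborel \<partial>nlborel)"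
    by (rule nn_integral_nlborel_swap) (simp add: K_def)
  also have "\<dots> = (\<integral>\<^sup>+y. \<integral>\<^sup>+z. \<integral>\<^sup>+u. (\<integral>\<^sup>+s. K y u s z \<partial>nlborel)\<^sup>2 \<partial>nlborel \<partial>nlborel \<partial>nlborel)"
    by (rule nn_integral_cong, rule nn_integral_nlborel_fst[symmetric]) (simp add: K_def)
  also have "\<dots> = (\<integral>\<^sup>+y. \<integral>\<^sup>+u. \<integral>\<^sup>+z. (\<integral>\<^sup>+s. K y u s z \<partial>nlborel)\<^sup>2 \<partial>nlborel \<partial>nlborel \<partial>nlborel)"
    by (rule nn_integral_cong, rule nn_integral_nlborel_swap) (simp add: K_def)
  also have "\<dots> \<le> (\<integral>\<^sup>+y. \<integral>\<^sup>+u. (\<integral>\<^sup>+s. r * M y u s \<partial>nlborel)\<^sup>2 \<partial>nlborel \<partial>nlborel)"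
    by (intro nn_integral_mono K_M)
  also have "\<dots> = r\<^sup>2 * (\<integral>\<^sup>+y. \<integral>\<^sup>+u. (\<integral>\<^sup>+s. M y u s \<partial>nlborel)\<^sup>2 \<partial>nlborel \<partial>nlborel)"
    by (simp add: M_def nn_integral_cmult power_mult_distrib)
  \<comment> \<open>The second block: \<open>quadrilinear_bound\<close> with \<open>\<phi>\<close>
    for both \<open>F1\<close> and \<open>F2\<close> and \<open>\<gamma>\<close> for both
    \<open>G1\<close> and \<open>G2\<close>.\<close>
  also have "\<dots> \<le> r\<^sup>2 * (2 ^ DIM('a) * ((?A * ?B) * (?A * ?B)))"
    unfolding M_def A[symmetric] B[symmetric] by (intro mult_left_mono quadrilinear_bound) auto
  also have "\<dots> = 4 ^ DIM('a) * (?A * ?B)\<^sup>2"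
  proof -
    have "(2 ^ n * (2 ^ n * (x * x)) :: ennreal) = 4 ^ n * x\<^sup>2" for n x
      by (simp add: power2_eq_square mult.assoc[symmetric] flip: power_mult_distrib)
    then show ?thesis by (simp add: r_def)
  qed
  finally show ?thesis .
qed

section \<open>Passage from the completed measure \<open>mu\<close> to the Borel measure\<close>

lemma AE_mu_iff: "(AE x in mu. P x) \<longleftrightarrow> (AE x in lborel. P (x :: 'a::euclidean_space))"
  unfolding mu_def by (subst AE_density) (simp_all add: AE_completion_iff)

lemma AE_nlborel_iff: "(AE x in nlborel. P x) \<longleftrightarrow> (AE x in lborel. P (x :: 'a::euclidean_space))"
  unfolding nlborel_def by (subst AE_density) simp_all

lemma nn_integral_mu:
  fixes F :: "'a::euclidean_space \<Rightarrow> ennreal"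
  assumes [measurable]: "F \<in> borel_measurable borel"
  shows "(\<integral>\<^sup>+x. F x \<partial>mu) = (\<integral>\<^sup>+x. F x \<partial>nlborel)"
proof -
  have "F \<in> borel_measurable lebesgue"
    by (intro measurable_completion) simp
  then show ?thesis
    unfolding mu_def by (simp add: nn_integral_density nn_integral_completion nn_integral_nlborel nn_integral_cmult)
qed

lemma integral_mu:
  fixes F :: "'a::euclidean_space \<Rightarrow> 'b::{banach, second_countable_topology}"
  assumes [measurable]: "F \<in> borel_measurable borel"
  shows "(\<integral>x. F x \<partial>mu) = (\<integral>x. F x \<partial>nlborel)"
proof -
  have "F \<in> borel_measurable lebesgue"
    by (intro measurable_completion) simp
  then show ?thesis
    unfolding mu_def by (subst integral_density) (simp_all add: integral_completion integral_nlborel)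
qed

lemma measurable_mu_iff: "F \<in> borel_measurable mu \<longleftrightarrow> F \<in> borel_measurable lebesgue"
  by (simp add: mu_def)

lemma ex_borel_quat:
  fixes f :: "'a::euclidean_space \<Rightarrow> quat"
  assumes f: "f \<in> borel_measurable lebesgue"
  shows "\<exists>f'\<in>borel_measurable borel. AE x in lborel. f x = f' x"
proof -
  have "\<forall>b. \<exists>u. u \<in> borel_measurable borel \<and> (AE x in lborel. f x \<bullet> b = u x)"
  proof
    fix b
    have "(\<lambda>x. f x \<bullet> b) \<in> borel_measurable lebesgue"
      using f by simp
    from completion_ex_borel_measurable_real[OF this]
    show "\<exists>u. u \<in> borel_measurable borel \<and> (AE x in lborel. f x \<bullet> b = u x)"
      by auto
  qed
  from choice[OF this] obtain u where
    u: "\<And>b. u b \<in> borel_measurable borel" "\<And>b. AE x in lborel. f x \<bullet> b = u b x"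
    by auto
  have "AE x in lborel. \<forall>b\<in>Basis. f x \<bullet> b = u b x"
    by (intro AE_finite_allI u) simp
  then have "AE x in lborel. f x = (\<Sum>b\<in>Basis. u b x *\<^sub>R b)"
  proof eventually_elim
    case (elim x)
    have "f x = (\<Sum>b\<in>Basis. (f x \<bullet> b) *\<^sub>R b)"
      by (rule euclidean_representation[symmetric])
    then show ?case using elim by simp
  qed
  moreover have "(\<lambda>x. \<Sum>b\<in>Basis. u b x *\<^sub>R b) \<in> borel_measurable borel"
    using u(1) by simp
  ultimately show ?thesis
    by (intro bexI[of _ "\<lambda>x. \<Sum>b\<in>Basis. u b x *\<^sub>R b"])
qed

text \<open>The maps sending \<open>t\<close> to \<open>x + t /\<^sub>R 2\<close> and to
  \<open>x - t /\<^sub>R 2\<close> only scale the measure, so preimages of null sets are null. This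
  holds for each fixed \<open>x\<close>, which is what changing \<open>f\<close> and
  \<open>g\<close> inside the transform requires.\<close>

lemma AE_lborel_half:
  fixes P :: "'a::euclidean_space \<Rightarrow> bool"
  assumes "AE x in lborel. P x"
  shows "AE t in lborel. P (x + t /\<^sub>R 2)" "AE t in lborel. P (x - t /\<^sub>R 2)"
proof -
  have "AE x in nlborel. P x"
    using assms by (simp add: AE_nlborel_iff)
  then obtain N where N: "{x. \<not> P x} \<subseteq> N" "emeasure nlborel N = 0" "N \<in> sets borel"
    by (auto elim!: AE_E)
  have [measurable]: "N \<in> sets borel" by fact
  have "(\<integral>\<^sup>+t. indicator N (x + t /\<^sub>R 2) \<partial>nlborel) = 2 ^ DIM('a) * (\<integral>\<^sup>+t. indicator N t \<partial>nlborel)"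
    by (rule nn_integral_nlborel_half(1)[where f = "indicator N"]) measurable
  then have "AE t in nlborel. indicator N (x + t /\<^sub>R 2) = (0::ennreal)"
    using N by (subst nn_integral_0_iff_AE[symmetric]) auto
  then show "AE t in lborel. P (x + t /\<^sub>R 2)"
    unfolding AE_nlborel_iff by eventually_elim (use N(1) in \<open>auto simp: indicator_def split: if_splits\<close>)
  have "(\<integral>\<^sup>+t. indicator N (x - t /\<^sub>R 2) \<partial>nlborel) = 2 ^ DIM('a) * (\<integral>\<^sup>+t. indicator N t \<partial>nlborel)"
    by (rule nn_integral_nlborel_half(2)[where f = "indicator N"]) measurable
  then have "AE t in nlborel. indicator N (x - t /\<^sub>R 2) = (0::ennreal)"
    using N by (subst nn_integral_0_iff_AE[symmetric]) auto
  then show "AE t in lborel. P (x - t /\<^sub>R 2)"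
    unfolding AE_nlborel_iff by eventually_elim (use N(1) in \<open>auto simp: indicator_def split: if_splits\<close>)
qed

text \<open>The equality holds at every point of phase space, so the entropies agree because the
  functions do, without an almost-everywhere argument on phase space.\<close>

lemma wigner_eq_nwigner:
  fixes f g f' g' :: "(real^'d) \<times> (real^'d) \<Rightarrow> quat"
  assumes [measurable]: "f' \<in> borel_measurable borel" "g' \<in> borel_measurable borel"
    and f: "AE x in lborel. f x = f' x" and g: "AE x in lborel. g x = g' x"
  shows "wigner f g x w = nwigner f' g' x w"
proof -
  let ?F = "\<lambda>f g t. exp (- ((fst w \<bullet> fst t) *\<^sub>R quat_i)) * f (x + t /\<^sub>R 2) * quat_cnj (g (x - t /\<^sub>R 2))
        * exp (- ((snd w \<bullet> snd t) *\<^sub>R quat_j))"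
  have [measurable]: "?F f' g' \<in> borel_measurable borel" by measurable
  have ae: "AE t in lborel. ?F f g t = ?F f' g' t"
    using AE_lborel_half(1)[OF f, of x] AE_lborel_half(2)[OF g, of x] by eventually_elim simp
  have m': "?F f' g' \<in> borel_measurable lebesgue"
    by (intro measurable_completion) simp
  have m: "?F f g \<in> borel_measurable lebesgue"
    using m' by (rule borel_measurable_AE) (use ae in \<open>auto simp: AE_completion_iff elim: eventually_mono\<close>)
  have "wigner f g x w = (\<integral>t. ?F f' g' t \<partial>mu)"
    unfolding wigner_def
    using m m' ae by (intro integral_cong_AE) (simp_all add: measurable_mu_iff AE_mu_iff)
  also have "\<dots> = nwigner f' g' x w"
    by (simp add: integral_mu nwigner_def cross_def mult.assoc)
  finally show ?thesis .
qed

section \<open>Entropy\<close>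

text \<open>The logarithm lies below its tangent at \<open>c\<close>, that is,
  \<open>ln p \<le> ln c + p / c - 1\<close>; this is multiplied by \<open>p\<close>.\<close>

lemma x_ln_x_le: "0 \<le> p \<Longrightarrow> 0 < c \<Longrightarrow> ln p * p \<le> p * ln c + p * p / c - p" for p c :: real
proof (cases "p = 0")
  case False
  assume "0 \<le> p" "0 < c"
  with False have "p > 0" by simp
  have "ln p - ln c = ln (p / c)"
    using \<open>p > 0\<close> \<open>c > 0\<close> by (simp add: ln_div)
  also have "\<dots> \<le> p / c - 1"
    using \<open>p > 0\<close> \<open>c > 0\<close> by (intro ln_le_minus_one) simp
  finally have "p * (ln p - ln c) \<le> p * (p / c - 1)"
    using \<open>p > 0\<close> by simp
  then show ?thesis by (simp add: algebra_simps)
qed simp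

text \<open>For a second moment bounded by \<open>m\<close>, the integrated tangent inequality gives
  \<open>N ln c + m / c - N\<close>, which is least at \<open>c = m / N\<close>. This is why the
  hypothesis couples \<open>m\<close> to \<open>c * N\<close>: the last two terms then
  cancel.\<close>

lemma phase_entropy_ge:
  fixes P :: "'a::euclidean_space \<times> 'a \<Rightarrow> real"
  assumes [measurable]: "P \<in> borel_measurable borel" and P: "\<And>z. P z \<ge> 0"
    and mass: "(\<integral>\<^sup>+z. ennreal (P z) \<partial>nlborel) = ennreal N" and "N \<ge> 0" and "c > 0"
    and sq: "(\<integral>\<^sup>+z. ennreal (P z * P z) \<partial>nlborel) \<le> ennreal (c * N)"
  shows "phase_entropy P \<ge> ereal (- N * ln c)"
proof -
  define L where "L z = ln (P z) * P z" for z
  have [measurable]: "L \<in> borel_measurable borel" unfolding L_def by measurable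
  have entropy: "phase_entropy P = - (enn2ereal (\<integral>\<^sup>+z. ennreal (L z) \<partial>nlborel) - enn2ereal (\<integral>\<^sup>+z. ennreal (- L z) \<partial>nlborel))"
    unfolding phase_entropy_def L_def by (subst (1 2) nn_integral_mu) simp_all
  have iP: "integrable nlborel P"
    using mass P \<open>N \<ge> 0\<close> by (intro integrableI_nonneg) auto
  have iPP: "integrable nlborel (\<lambda>z. P z * P z)"
    using sq P by (intro integrableI_nonneg) (auto intro: order_le_less_trans[OF sq])
  have NP: "(\<integral>z. P z \<partial>nlborel) = N"
    using mass P \<open>N \<ge> 0\<close> nn_integral_eq_integral[OF iP] by (simp add: integral_nonneg_AE)
  have "ennreal (\<integral>z. P z * P z \<partial>nlborel) \<le> ennreal (c * N)"
    using sq P nn_integral_eq_integral[OF iPP] by simp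
  then have SP: "(\<integral>z. P z * P z \<partial>nlborel) \<le> c * N"
    using \<open>N \<ge> 0\<close> \<open>c > 0\<close> by simp
  \<comment> \<open>The tangent inequality at \<open>c = 1\<close>. It makes the positive part of
    \<open>P ln P\<close> integrable, which rules out the undefined difference of two
    infinities.\<close>
  have "L z \<le> P z * P z" for z
    using x_ln_x_le[OF P, of 1 z] P[of z] by (simp add: L_def)
  then have le: "(\<integral>\<^sup>+z. ennreal (L z) \<partial>nlborel) \<le> (\<integral>\<^sup>+z. ennreal (P z * P z) \<partial>nlborel)"
    by (intro nn_integral_mono ennreal_leI)
  have pos: "(\<integral>\<^sup>+z. ennreal (L z) \<partial>nlborel) < \<infinity>"
    by (rule order_le_less_trans[OF order_trans[OF le sq]]) simp
  show ?thesis
  proof (cases "(\<integral>\<^sup>+z. ennreal (- L z) \<partial>nlborel) = \<infinity>")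
    \<comment> \<open>An infinite negative part makes the entropy
      \<open>\<infinity>\<close>.\<close>
    case True
    then show ?thesis
      using pos unfolding entropy by (cases "\<integral>\<^sup>+z. ennreal (L z) \<partial>nlborel") auto
  next
    case False
    have iL: "integrable nlborel L"
      using pos False by (auto simp: real_integrable_def)
    have "(\<integral>z. L z \<partial>nlborel) \<le> (\<integral>z. P z * ln c + P z * P z / c - P z \<partial>nlborel)"
      unfolding L_def using iL iP iPP \<open>c > 0\<close> P
      by (intro integral_mono) (auto simp: L_def[abs_def] intro!: x_ln_x_le)
    also have "\<dots> = N * ln c + (\<integral>z. P z * P z \<partial>nlborel) / c - N"
      using iP iPP NP by simp
    also have "\<dots> \<le> N * ln c + (c * N) / c - N"
      using SP \<open>c > 0\<close> by (intro diff_mono add_mono divide_right_mono) auto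
    finally have le: "(\<integral>z. L z \<partial>nlborel) \<le> N * ln c"
      using \<open>c > 0\<close> by simp
    obtain a where a: "(\<integral>\<^sup>+z. ennreal (L z) \<partial>nlborel) = ennreal a" "a \<ge> 0"
      using pos by (cases "\<integral>\<^sup>+z. ennreal (L z) \<partial>nlborel") auto
    obtain b where b: "(\<integral>\<^sup>+z. ennreal (- L z) \<partial>nlborel) = ennreal b" "b \<ge> 0"
      using False by (cases "\<integral>\<^sup>+z. ennreal (- L z) \<partial>nlborel") auto
    have "(\<integral>z. L z \<partial>nlborel) = a - b"
      using a b by (simp add: real_lebesgue_integral_def[OF iL])
    then show ?thesis
      using le a b unfolding entropy by simp
  qed
qed

lemma L2_borel_representative:
  fixes f :: "'a::euclidean_space \<Rightarrow> quat"
  assumes f: "f \<in> L2"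
  obtains f' where "f' \<in> borel_measurable borel" "AE x in lborel. f x = f' x"
    "(\<integral>\<^sup>+x. (ennreal (norm (f' x)))\<^sup>2 \<partial>nlborel) = ennreal ((L2_norm f)\<^sup>2)"
proof -
  obtain f' where [measurable]: "f' \<in> borel_measurable borel" and ae: "AE x in lborel. f x = f' x"
    using ex_borel_quat[of f] f by (auto simp: L2_def)
  have i: "integrable mu (\<lambda>x. (norm (f x))\<^sup>2)"
    using f by (simp add: L2_def)
  have "(\<integral>\<^sup>+x. (ennreal (norm (f' x)))\<^sup>2 \<partial>nlborel) = (\<integral>\<^sup>+x. (ennreal (norm (f' x)))\<^sup>2 \<partial>mu)"
    by (rule nn_integral_mu[symmetric]) simp
  also have "\<dots> = (\<integral>\<^sup>+x. ennreal ((norm (f x))\<^sup>2) \<partial>mu)"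
    using ae by (intro nn_integral_cong_AE) (auto simp: AE_mu_iff ennreal_power elim: eventually_mono)
  also have "\<dots> = ennreal ((L2_norm f)\<^sup>2)"
    by (simp add: nn_integral_eq_integral[OF i] L2_norm_def)
  finally have *: "(\<integral>\<^sup>+x. (ennreal (norm (f' x)))\<^sup>2 \<partial>nlborel) = ennreal ((L2_norm f)\<^sup>2)" .
  show ?thesis
    by (rule that[OF _ ae *]) simp
qed

text \<open>Positivity of both norms is what makes the constant \<open>c\<close> positive and lets
  the logarithms be split.\<close>

lemma L2_norm_pos:
  fixes f :: "'a::euclidean_space \<Rightarrow> quat"
  assumes f: "f \<in> L2" and nz: "\<not> (AE x in lebesgue. f x = 0)"
  shows "(L2_norm f)\<^sup>2 > 0"
proof (rule ccontr)
  assume "\<not> (L2_norm f)\<^sup>2 > 0"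
  then have 0: "(L2_norm f)\<^sup>2 = 0" by simp
  obtain f' where [measurable]: "f' \<in> borel_measurable borel" and ae: "AE x in lborel. f x = f' x"
    and mass: "(\<integral>\<^sup>+x. (ennreal (norm (f' x)))\<^sup>2 \<partial>nlborel) = ennreal ((L2_norm f)\<^sup>2)"
    by (rule L2_borel_representative[OF f])
  have "AE x in nlborel. (ennreal (norm (f' x)))\<^sup>2 = 0"
    using mass unfolding 0 by (subst nn_integral_0_iff_AE[symmetric]) simp_all
  then have "AE x in lborel. f x = 0"
    using ae unfolding AE_nlborel_iff by eventually_elim simp
  then show False
    using nz by (simp add: AE_completion_iff)
qed

theorem corollary10:
  fixes f g :: "(real^'d) \<times> (real^'d) \<Rightarrow> quat"
  assumes "f \<in> L2" and "g \<in> L2"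
    and "\<not> (AE x in lebesgue. f x = 0)" and "\<not> (AE x in lebesgue. g x = 0)"
  shows "phase_entropy (\<lambda>(x, w). (norm (wigner f g x w))\<^sup>2)
    \<ge> ereal ((L2_norm f)\<^sup>2 * (L2_norm g)\<^sup>2 *
        (2 * real CARD('d) * ln 2
          - ln (2 ^ (4 * CARD('d)) * (L2_norm f)\<^sup>2 * (L2_norm g)\<^sup>2)))"
proof -
  let ?d = "CARD('d)"
  obtain f' where [measurable]: "f' \<in> borel_measurable borel" and f': "AE x in lborel. f x = f' x"
    and mf: "(\<integral>\<^sup>+x. (ennreal (norm (f' x)))\<^sup>2 \<partial>nlborel) = ennreal ((L2_norm f)\<^sup>2)"
    by (rule L2_borel_representative[OF \<open>f \<in> L2\<close>])
  obtain g' where [measurable]: "g' \<in> borel_measurable borel" and g': "AE x in lborel. g x = g' x"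
    and mg: "(\<integral>\<^sup>+x. (ennreal (norm (g' x)))\<^sup>2 \<partial>nlborel) = ennreal ((L2_norm g)\<^sup>2)"
    by (rule L2_borel_representative[OF \<open>g \<in> L2\<close>])
  define a where "a = (L2_norm f)\<^sup>2"
  define b where "b = (L2_norm g)\<^sup>2"
  have pos: "a > 0" "b > 0"
    unfolding a_def b_def by (rule L2_norm_pos[OF assms(1,3)], rule L2_norm_pos[OF assms(2,4)])
  define P where "P z = (norm (nwigner f' g' (fst z) (snd z)))\<^sup>2" for z
  have P: "(\<lambda>(x, w). (norm (wigner f g x w))\<^sup>2) = P"
    by (auto simp: P_def wigner_eq_nwigner[OF _ _ f' g'])
  have "phase_entropy P \<ge> ereal (- (a * b) * ln (4 ^ ?d * (a * b)))"
  proof (rule phase_entropy_ge)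
    show "P \<in> borel_measurable borel"
      unfolding P_def by measurable
    show "(\<integral>\<^sup>+z. ennreal (P z) \<partial>nlborel) = ennreal (a * b)"
      unfolding P_def using pos
      by (subst nwigner_mass) (simp_all add: mf mg a_def b_def ennreal_mult)
    have "(\<integral>\<^sup>+z. ennreal (P z * P z) \<partial>nlborel) \<le> 4 ^ ?d * (ennreal a * ennreal b)\<^sup>2"
      using nwigner_fourth[of f' g'] unfolding P_def by (simp add: mf mg a_def b_def)
    also have "\<dots> = ennreal ((4 ^ ?d * (a * b)) * (a * b))"
      using pos by (simp add: ennreal_mult ennreal_power power2_eq_square mult_ac flip: ennreal_power)
    finally show "(\<integral>\<^sup>+z. ennreal (P z * P z) \<partial>nlborel) \<le> ennreal ((4 ^ ?d * (a * b)) * (a * b))" .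
  qed (use pos in \<open>simp_all add: P_def\<close>)
  \<comment> \<open>One block has dimension \<open>?d\<close>, so \<open>nwigner_fourth\<close>
    yields \<open>4 ^ ?d\<close>. It matches the claim since \<open>4 ?d ln 2 - 2 ?d ln 2\<close>
    equals \<open>ln (4 ^ ?d)\<close>.\<close>
  moreover have "a * b * (2 * real ?d * ln 2 - ln (2 ^ (4 * ?d) * a * b)) = - (a * b) * ln (4 ^ ?d * (a * b))"
  proof -
    have "ln (2 ^ (4 * ?d) * a * b) = 4 * real ?d * ln 2 + ln (a * b)"
      using pos by (simp add: ln_mult ln_realpow)
    moreover have "ln (4 ^ ?d * (a * b)) = 2 * real ?d * ln 2 + ln (a * b)"
      using pos ln_realpow[of "2::real" 2] by (simp add: ln_mult ln_realpow)
    ultimately show ?thesis by (simp add: algebra_simps)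
  qed
  ultimately show ?thesis
    unfolding P a_def b_def by simp
qed

end
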